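(* For all $s\ge1$, $$\left\{F\in\mathbb C_\infty[X_1,\dots,X_s]\ ;\ \mathfrak L(F,Z)\in\mathbb C_\infty[X_1,\dots,X_s,Z]\right\}=A[X_1,\dots,X_s].$$
   Context: $\mathbb F_q$ is a finite field with $q$ elements, $A=\mathbb F_q[\theta]$, $A_{+,d}$ is the set of monic elements of degree $d$ of $A$. $\mathbb C_\infty$ is the completion of an algebraic closure of $\mathbb F_q((1/\theta))$. The Carlitz module is the $\mathbb F_q$-algebra morphism $a\mapsto C_a$ from $A$ to $\mathbb F_q$-linear polynomials over $A$ (under composition) with $C_\theta(X)=\theta X+X^q$. $D_0=1$, $D_i=(\theta^{q^i}-\theta)D_{i-1}^q$ for $i\ge 1$, and $\exp_C(G)=\sum_{i\ge0}G^{q^i}/D_i$ for $G\in Z\,\mathbb C_\infty[X_1,\dots,X_s][[Z]]$. For $F\in\mathbb C_\infty[X_1,\dots,X_s]$, $$\mathfrak L(F,Z)=\exp_C\Big(\sum_{d\ge0}Z^{q^d}\sum_{a\in A_{+,d}}\frac{F(C_a(X_1),\dots,C_a(X_s))}{a}\Big)\in\mathbb C_\infty[X_1,\dots,X_s][[Z]].$$ *)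

theory Defs
  imports
    "HOL-Analysis.Abstract_Metric_Spaces"
    "HOL-Algebra.Algebraic_Closure_Type"
    "HOL-Computational_Algebra.Computational_Algebra"
    "HOL-Library.Poly_Mapping"
begin

text \<open>
  The field with \<open>q\<close> elements is a type \<open>'q\<close> of sort \<open>{field, finite}\<close> with \<open>q = CARD('q)\<close>;
  \<open>A\<close> is \<open>'q poly\<close>, the polynomial variable being \<open>\<theta>\<close>. The field of formal Laurent series in
  \<open>1/\<theta>\<close> is \<open>'q fls\<close>, the series variable being \<open>1/\<theta>\<close>; thus \<open>\<theta>\<close> is \<open>fls_X_inv\<close> there.
\<close>

definition fls_abs :: "'q::{field,finite} fls \<Rightarrow> real" where
  "fls_abs f = (if f = 0 then 0 else real CARD('q) powi (- fls_subdegree f))"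

text \<open>
  The field \<open>'c\<close> with absolute value \<open>v\<close> is a completion, along the embedding \<open>j\<close>, of an
  algebraic closure of \<open>'q fls\<close>. The absolute value on the closure is the restriction of \<open>v\<close>;
  it is the unique one extending \<^const>\<open>fls_abs\<close>. These data are determined up to isometric
  isomorphism.
\<close>

locale C_infinity =
  fixes j :: "'q::{field,finite} fls alg_closure \<Rightarrow> 'c::field"
    and v :: "'c \<Rightarrow> real"
  assumes hom_one: "j 1 = 1"
    and hom_add: "\<And>x y. j (x + y) = j x + j y"
    and hom_mult: "\<And>x y. j (x * y) = j x * j y"
    and abs_nonneg: "\<And>x. v x \<ge> 0"
    and abs_eq_0_iff: "\<And>x. v x = 0 \<longleftrightarrow> x = 0"
    and abs_mult: "\<And>x y. v (x * y) = v x * v y"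
    and abs_ultrametric: "\<And>x y. v (x + y) \<le> max (v x) (v y)"
    and abs_extends: "\<And>f. v (j (to_ac f)) = fls_abs f"
    and complete: "Metric_space.mcomplete UNIV (\<lambda>x y. v (x - y))"
    and dense: "\<And>x e. e > 0 \<Longrightarrow> \<exists>y. v (x - j y) < e"
begin

lemma Metric_space_abs: "Metric_space UNIV (\<lambda>x y. v (x - y))"
proof
  have v1: "v 1 = 1"
    using abs_mult[of 1 1] abs_eq_0_iff[of 1] by simp
  then have "v (-1) * v (-1) = 1"
    using abs_mult[of "-1" "-1"] by simp
  then have vm1: "v (-1) = 1"
    using abs_nonneg[of "-1"] by (metis abs_of_nonneg abs_square_eq_1 power2_eq_square)
  show "v (x - y) = v (y - x)" for x y
    using abs_mult[of "-1" "y - x"] vm1 by simp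
  show "v (x - z) \<le> v (x - y) + v (y - z)" for x y z
    using abs_ultrametric[of "x - y" "y - z"] abs_nonneg[of "x - y"] abs_nonneg[of "y - z"]
    by (simp split: if_splits add: max_def)
qed (simp_all add: abs_nonneg abs_eq_0_iff)

end

definition A_emb :: "('q::field fls alg_closure \<Rightarrow> 'c) \<Rightarrow> 'q poly \<Rightarrow> 'c" where
  "A_emb j a = j (to_ac (poly (map_poly fls_const a) fls_X_inv))"

definition A_plus :: "nat \<Rightarrow> 'q::field poly set" where
  "A_plus d = {a. lead_coeff a = 1 \<and> degree a = d}"


subsection \<open>The Carlitz module\<close>

text \<open>
  Polynomials over \<open>A\<close> are of type \<open>'q poly poly\<close>, the outer variable being \<open>X\<close>.
\<close>

definition carlitz_theta :: "'q::{field,finite} poly poly" where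
  "carlitz_theta = smult [:0, 1:] [:0, 1:] + [:0, 1:] ^ CARD('q)"

definition carlitz :: "'q::{field,finite} poly \<Rightarrow> 'q poly poly" where
  "carlitz a = (\<Sum>i\<le>degree a. smult [:coeff a i:] ((pcompose carlitz_theta ^^ i) [:0, 1:]))"

text \<open>
  We check that \<^const>\<open>carlitz\<close> is the morphism of algebras over the finite field, with values in
  the additive polynomials under composition, that sends \<open>\<theta>\<close> to \<^const>\<open>carlitz_theta\<close>.
\<close>

lemma finite_field_power_card:
  fixes x :: "'q::{field,finite}"
  shows "x ^ CARD('q) = x"
proof (cases "x = 0")
  case False
  let ?U = "UNIV - {0::'q}"
  have bij: "bij_betw ((*) x) ?U ?U"
    by (rule bij_betwI[where g = "(*) (inverse x)"]) (use False in auto)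
  have "(\<Prod>y\<in>?U. x * y) = (\<Prod>y\<in>?U. y)"
    using prod.reindex_bij_betw[OF bij, of "\<lambda>y. y"] by simp
  then have "x ^ card ?U * (\<Prod>y\<in>?U. y) = (\<Prod>y\<in>?U. y)"
    by (simp add: prod.distrib)
  then have "x ^ card ?U = 1"
    by simp
  moreover have "CARD('q) = Suc (card ?U)"
    by (simp add: card_Diff_singleton)
  ultimately show ?thesis
    by (metis power_Suc mult_1_right)
qed (simp add: zero_power)

lemma of_nat_card_choose:
  assumes "0 < k" "k < CARD('q)"
  shows "of_nat (CARD('q) choose k) = (0 :: 'q::{field,finite})"
proof -
  let ?q = "CARD('q)"
  define P :: "'q poly" where "P = [:1, 1:] ^ ?q - monom 1 ?q - 1"
  have cf: "coeff P i = (if i = 0 \<or> i \<ge> ?q then 0 else of_nat (?q choose i))" for i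
  proof (cases "i \<le> ?q")
    case True
    then show ?thesis
      by (auto simp: P_def coeff_linear_poly_power)
  next
    case False
    then have "coeff ([:1, 1::'q:] ^ ?q) i = 0"
      by (intro coeff_eq_0) (simp add: degree_linear_power)
    with False show ?thesis
      by (auto simp: P_def)
  qed
  have "P = 0"
  proof (rule ccontr)
    assume "P \<noteq> 0"
    have "poly P x = 0" for x
      by (simp add: P_def poly_monom finite_field_power_card)
    then have "?q \<le> degree P"
      using card_poly_roots_bound[OF \<open>P \<noteq> 0\<close>] by simp
    then have "coeff P (degree P) = 0"
      using cf by auto
    with \<open>P \<noteq> 0\<close> show False
      by simp
  qed
  then have "coeff P k = 0"
    by simp
  then show ?thesis
    using assms by (simp add: cf)
qed

lemma frobenius_add:
  fixes x y :: "'q::{field,finite} poly poly"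
  shows "(x + y) ^ CARD('q) = x ^ CARD('q) + y ^ CARD('q)"
proof -
  let ?q = "CARD('q)"
  have *: "of_nat (?q choose k) = (0 :: 'q poly poly)" if "0 < k" "k < ?q" for k
    using of_nat_card_choose[OF that] by (simp add: of_nat_poly)
  have "(x + y) ^ ?q = (\<Sum>k\<le>?q. of_nat (?q choose k) * x ^ k * y ^ (?q - k))"
    by (rule binomial_ring)
  also have "\<dots> = (\<Sum>k\<in>{0, ?q}. of_nat (?q choose k) * x ^ k * y ^ (?q - k))"
    by (rule sum.mono_neutral_right) (auto simp: *)
  finally show ?thesis
    by (simp add: add.commute)
qed

lemma pcompose_carlitz_theta:
  "pcompose carlitz_theta P = smult [:0, 1:] P + P ^ CARD('q)"
  for P :: "'q::{field,finite} poly poly"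
proof -
  have "pcompose (Q ^ n) P = pcompose Q P ^ n" for Q :: "'q poly poly" and n
    by (induction n) (simp_all add: pcompose_1 pcompose_mult)
  then show ?thesis
    by (simp add: carlitz_theta_def pcompose_add pcompose_smult pcompose_pCons del: smult_pCons)
qed

lemma pcompose_carlitz_theta_add:
  "pcompose carlitz_theta (P + Q) = pcompose carlitz_theta P + pcompose carlitz_theta Q"
  by (simp add: pcompose_carlitz_theta frobenius_add smult_add_right)

lemma pcompose_carlitz_theta_smult:
  "pcompose carlitz_theta (smult [:c:] P) = smult [:c:] (pcompose carlitz_theta P)"
  for c :: "'a::{field,finite}"
proof -
  have "[:c:] ^ CARD('a) = [:c:]"
    by (simp add: poly_const_pow finite_field_power_card)
  then have "smult [:c:] P ^ CARD('a) = smult [:c:] (P ^ CARD('a))"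
    using smult_power[of "[:c:]" P "CARD('a)"] by simp
  then show ?thesis
    by (simp add: pcompose_carlitz_theta smult_add_right mult.commute)
qed

lemma pcompose_carlitz_theta_sum:
  "pcompose carlitz_theta (\<Sum>i\<in>I. f i) = (\<Sum>i\<in>I. pcompose carlitz_theta (f i))"
proof (induction I rule: infinite_finite_induct)
  case (insert x F)
  then show ?case
    by (simp add: pcompose_carlitz_theta_add)
qed (simp_all add: pcompose_carlitz_theta)

lemma carlitz_eq_sum:
  assumes "degree a \<le> n"
  shows "carlitz a = (\<Sum>i\<le>n. smult [:coeff a i:] ((pcompose carlitz_theta ^^ i) [:0, 1:]))"
  unfolding carlitz_def using assms
  by (intro sum.mono_neutral_left) (auto simp: coeff_eq_0)

lemma carlitz_add: "carlitz (a + b) = carlitz a + carlitz b"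
proof -
  define n where "n = max (degree a) (degree b)"
  have n: "degree a \<le> n" "degree b \<le> n" "degree (a + b) \<le> n"
    by (auto simp: n_def intro: degree_add_le)
  have pc: "[:x + y:] = [:x:] + [:y:]" for x y :: 'a
    by simp
  show ?thesis
    by (simp add: n[THEN carlitz_eq_sum] sum.distrib pc smult_add_left del: add_pCons)
qed

lemma carlitz_smult: "carlitz (smult c a) = smult [:c:] (carlitz a)"
proof -
  have "smult b (\<Sum>i\<in>I. f i) = (\<Sum>i\<in>I. smult b (f i))" for b :: "'a poly" and f and I :: "nat set"
    by (induction I rule: infinite_finite_induct) (simp_all add: smult_add_right)
  then show ?thesis
    using carlitz_eq_sum[OF degree_smult_le[of c a]]
    by (simp add: carlitz_def mult.commute)
qed

lemma carlitz_pCons: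
  "carlitz (pCons c a) = smult [:c:] [:0, 1:] + pcompose carlitz_theta (carlitz a)"
proof -
  have "carlitz (pCons c a) =
    (\<Sum>i\<le>Suc (degree a). smult [:coeff (pCons c a) i:] ((pcompose carlitz_theta ^^ i) [:0, 1:]))"
    by (rule carlitz_eq_sum) (rule degree_pCons_le)
  also have "\<dots> = smult [:c:] [:0, 1:] + pcompose carlitz_theta (carlitz a)"
    by (subst sum.atMost_Suc_shift)
      (simp add: carlitz_def pcompose_carlitz_theta_sum pcompose_carlitz_theta_smult
        del: smult_pCons)
  finally show ?thesis .
qed

lemma carlitz_0 [simp]: "carlitz 0 = 0"
  by (simp add: carlitz_def)

lemma carlitz_1: "carlitz 1 = [:0, 1:]"
  by (simp add: carlitz_def)

lemma carlitz_at_theta: "carlitz [:0, 1:] = carlitz_theta"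
proof -
  have "carlitz (pCons 0 1) = pcompose carlitz_theta [:0, 1:]"
    by (simp add: carlitz_pCons carlitz_1)
  then show ?thesis
    by (metis pcompose_idR one_pCons)
qed

lemma carlitz_mult: "carlitz (a * b) = pcompose (carlitz a) (carlitz b)"
proof (induction a)
  case (pCons c a)
  have "carlitz (pCons c a * b) =
    smult [:c:] (carlitz b) + pcompose carlitz_theta (pcompose (carlitz a) (carlitz b))"
    by (simp add: carlitz_add carlitz_smult carlitz_pCons pCons.IH)
  also have "\<dots> = pcompose (carlitz (pCons c a)) (carlitz b)"
    by (simp add: carlitz_pCons pcompose_add pcompose_smult pcompose_assoc pcompose_pCons
        del: smult_pCons)
  finally show ?case .
qed simp

lemma pcompose_carlitz_add:
  "pcompose (carlitz a) (P + Q) = pcompose (carlitz a) P + pcompose (carlitz a) Q"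
  by (induction a)
    (simp_all add: carlitz_pCons pcompose_add pcompose_smult pcompose_pCons smult_add_right
      pcompose_carlitz_theta_add del: smult_pCons flip: pcompose_assoc)

lemma pcompose_carlitz_smult:
  "pcompose (carlitz a) (smult [:c:] P) = smult [:c:] (pcompose (carlitz a) P)"
  by (induction a)
    (simp_all add: carlitz_pCons pcompose_add pcompose_smult pcompose_pCons smult_add_right
      pcompose_carlitz_theta_smult mult.commute del: smult_pCons flip: pcompose_assoc)

primrec carlitz_D :: "nat \<Rightarrow> 'q::{field,finite} poly" where
  "carlitz_D 0 = 1"
| "carlitz_D (Suc i) = ([:0, 1:] ^ (CARD('q) ^ Suc i) - [:0, 1:]) * carlitz_D i ^ CARD('q)"


subsection \<open>Polynomials in several variables\<close>

text \<open>
  A monomial is a finitely supported map from indices of variables to exponents. The polynomials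
  in \<open>X\<^sub>1, \<dots>, X\<^sub>s\<close> are those in which only variables with index in \<open>{1..s}\<close> occur.
\<close>

type_synonym 'c mpol = "(nat \<Rightarrow>\<^sub>0 nat) \<Rightarrow>\<^sub>0 'c"

definition mpols :: "nat \<Rightarrow> 'c::zero set \<Rightarrow> 'c mpol set" where
  "mpols s R = {F. \<forall>m\<in>Poly_Mapping.keys F.
     Poly_Mapping.keys m \<subseteq> {1..s} \<and> Poly_Mapping.lookup F m \<in> R}"

definition mconst :: "'c::zero \<Rightarrow> 'c mpol" where
  "mconst c = Poly_Mapping.single 0 c"

definition mvar :: "nat \<Rightarrow> 'c::zero_neq_one mpol" where
  "mvar i = Poly_Mapping.single (Poly_Mapping.single i 1) 1"

definition msubst :: "'c::comm_ring_1 mpol \<Rightarrow> (nat \<Rightarrow> 'c mpol) \<Rightarrow> 'c mpol" where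
  "msubst F g = (\<Sum>m\<in>Poly_Mapping.keys F. mconst (Poly_Mapping.lookup F m) *
     (\<Prod>i\<in>Poly_Mapping.keys m. g i ^ Poly_Mapping.lookup m i))"

definition mpols_Z :: "nat \<Rightarrow> 'c::comm_ring_1 mpol fps set" where
  "mpols_Z s = fps_of_poly ` {P. \<forall>n. coeff P n \<in> mpols s UNIV}"


subsection \<open>The series \<open>L(F, Z)\<close>\<close>

definition carlitz_var :: "('q::{field,finite} fls alg_closure \<Rightarrow> 'c::field) \<Rightarrow> 'q poly \<Rightarrow> nat \<Rightarrow> 'c mpol" where
  "carlitz_var j a i = poly (map_poly (\<lambda>b. mconst (A_emb j b)) (carlitz a)) (mvar i)"

text \<open>
  The infinite sums are taken in the topology of formal power series, in which convergence means
  that each coefficient is eventually constant.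
\<close>

definition exp_C :: "('q::{field,finite} fls alg_closure \<Rightarrow> 'c::field) \<Rightarrow> 'c mpol fps \<Rightarrow> 'c mpol fps" where
  "exp_C j G = suminf (\<lambda>i. fps_const (mconst (inverse (A_emb j (carlitz_D i)))) * G ^ (CARD('q) ^ i))"

definition L_coeff :: "('q::{field,finite} fls alg_closure \<Rightarrow> 'c::field) \<Rightarrow> 'c mpol \<Rightarrow> nat \<Rightarrow> 'c mpol" where
  "L_coeff j F d =
     (\<Sum>a\<in>A_plus d. mconst (inverse (A_emb j a)) * msubst F (carlitz_var j a))"

definition L_arg :: "('q::{field,finite} fls alg_closure \<Rightarrow> 'c::field) \<Rightarrow> 'c mpol \<Rightarrow> 'c mpol fps" where
  "L_arg j F = suminf (\<lambda>d. fps_const (L_coeff j F d) * fps_X ^ (CARD('q) ^ d))"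

definition L_series :: "('q::{field,finite} fls alg_closure \<Rightarrow> 'c::field) \<Rightarrow> 'c mpol \<Rightarrow> 'c mpol fps" where
  "L_series j F = exp_C j (L_arg j F)"

lemma finite_A_plus: "finite (A_plus d :: 'q::{field,finite} poly set)"
proof -
  have "inj_on coeffs (A_plus d :: 'q poly set)"
    by (rule inj_onI) (simp add: coeffs_eq_iff)
  moreover have "coeffs ` (A_plus d :: 'q poly set) \<subseteq> {xs. set xs \<subseteq> UNIV \<and> length xs = Suc d}"
    by (force simp: A_plus_def intro!: length_coeffs_degree)
  then have "finite (coeffs ` (A_plus d :: 'q poly set))"
    using finite_lists_length_eq[of "UNIV :: 'q set" "Suc d"] finite_subset by auto
  ultimately show ?thesis
    by (rule finite_imageD[rotated])
qed

lemma sums_fpsI: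
  fixes f :: "nat \<Rightarrow> 'a::comm_ring_1 fps"
  assumes "\<And>i n. n < i \<Longrightarrow> fps_nth (f i) n = 0"
  shows "f sums Abs_fps (\<lambda>n. \<Sum>i\<le>n. fps_nth (f i) n)"
  unfolding sums_def
proof (rule tendsto_fpsI)
  fix n
  show "\<forall>\<^sub>F m in sequentially. fps_nth (\<Sum>i<m. f i) n = fps_nth (Abs_fps (\<lambda>n. \<Sum>i\<le>n. fps_nth (f i) n)) n"
    using eventually_gt_at_top[of n]
  proof eventually_elim
    case (elim m)
    have "(\<Sum>i<m. fps_nth (f i) n) = (\<Sum>i\<le>n. fps_nth (f i) n)"
      using elim assms by (intro sum.mono_neutral_right) auto
    then show ?case
      by (simp add: fps_sum_nth)
  qed
qed

lemma less_card_power: "i < CARD('q::{field,finite}) ^ i"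
proof -
  have "card {0, 1::'q} \<le> CARD('q)"
    by (rule card_mono) auto
  then have "1 < CARD('q)"
    by simp
  then show ?thesis
    by (intro power_gt_expt) auto
qed

lemma L_arg_sums: "(\<lambda>d. fps_const (L_coeff j F d) * fps_X ^ (CARD('q) ^ d)) sums L_arg j F"
  for j :: "'q::{field,finite} fls alg_closure \<Rightarrow> 'c::field"
proof -
  have "n \<noteq> CARD('q) ^ i" if "n < i" for i n
    using less_card_power[of i, where 'q = 'q] that by linarith
  then show ?thesis
    unfolding L_arg_def by (intro summable_sums sums_summable[OF sums_fpsI]) (auto simp: fps_X_power_nth)
qed

lemma L_arg_nth_0: "fps_nth (L_arg j F) 0 = 0"
  for j :: "'q::{field,finite} fls alg_closure \<Rightarrow> 'c::field"
proof -
  have "L_arg j F = Abs_fps (\<lambda>n. \<Sum>i\<le>n. fps_nth (fps_const (L_coeff j F i) * fps_X ^ (CARD('q) ^ i)) n)"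
    unfolding L_arg_def
  proof (rule sums_unique[symmetric], rule sums_fpsI)
    fix i n :: nat assume "n < i"
    then show "fps_nth (fps_const (L_coeff j F i) * fps_X ^ (CARD('q) ^ i)) n = 0"
      using less_card_power[of i, where 'q = 'q] by auto
  qed
  then show ?thesis
    by simp
qed

lemma exp_C_sums:
  fixes j :: "'q::{field,finite} fls alg_closure \<Rightarrow> 'c::field"
  assumes "fps_nth G 0 = 0"
  shows "(\<lambda>i. fps_const (mconst (inverse (A_emb j (carlitz_D i)))) * G ^ (CARD('q) ^ i)) sums exp_C j G"
proof -
  have "fps_nth (G ^ (CARD('q) ^ i)) n = 0" if "n < i" for i n
    using less_card_power[of i, where 'q = 'q] that
    by (intro startsby_zero_power_prefix[OF assms, rule_format]) auto
  then show ?thesis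
    unfolding exp_C_def by (intro summable_sums sums_summable[OF sums_fpsI]) auto
qed

end

theory Submission
  imports Defs
begin

text \<open>
  Put \<open>S\<^sub>d(F) = \<Sum> F(C\<^sub>a(X)) / a\<close>, the sum over the monic \<open>a\<close> of degree \<open>d\<close>. Raising to the power
  \<open>q\<close> is additive, so only the powers \<open>Z^(q^n)\<close> occur in \<open>L(F, Z)\<close>, and the coefficient there is
  \<open>T\<^sub>n(F) = \<Sum>\<^sub>i S\<^sub>n\<^sub>-\<^sub>i(F)^(q^i) / D\<^sub>i\<close>. The series is a polynomial in \<open>Z\<close> iff \<open>T\<^sub>n(F) = 0\<close> for large \<open>n\<close>,
  and the claim is that this happens exactly when \<open>F\<close> has coefficients in \<open>A\<close>.

  Reduction to one variable. Substituting \<open>C\<^sub>b(X)\<close>, with \<open>b = \<theta>^(k i)\<close>, for \<open>X\<^sub>i\<close> commutes with all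
  \<open>T\<^sub>n\<close>, because the \<open>C\<^sub>a\<close> commute with each other. The image of a monomial is monic of degree
  \<open>\<Sum> m\<^sub>i q^(k i)\<close>, so for large \<open>k\<close> distinct monomials get distinct degrees. Hence the substitution
  reflects both vanishing and integrality (\<open>kronecker_reflects\<close>).

  From \<open>A\<close> to vanishing (Anderson's log-algebraicity). It has an arithmetic and an analytic half.

  Arithmetic: \<open>T\<^sub>n(F)\<close> has coefficients in \<open>A\<close> (\<open>L_term_integral\<close>). This is checked at each monic prime
  \<open>P\<close> of \<open>A\<close>. Let \<open>e = deg P\<close>, let \<open>G = \<Sum> S\<^sub>d(F) Z^(q^d)\<close> and \<open>u = exp\<^sub>C(G)\<close>, and let \<open>\<sigma>\<close> send \<open>X\<close> to
  \<open>C\<^sub>P(X)\<close> and \<open>Z\<close> to \<open>Z^(q^e)\<close>. Collecting the terms of \<open>G\<close> with \<open>P | a\<close> gives \<open>P G = P g + \<sigma>(G)\<close> with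
  \<open>g\<close> integral at \<open>P\<close>. Applying \<open>exp\<^sub>C\<close> turns this into \<open>C\<^sub>P(u) = exp\<^sub>C(P g) + \<sigma>(u)\<close>. Modulo \<open>P\<close> the
  polynomial \<open>C\<^sub>P\<close> is \<open>X^(q^e)\<close>, the map \<open>\<sigma>\<close> is the power \<open>q^e\<close>, and \<open>exp\<^sub>C(P g)\<close> vanishes. So \<open>P u\<close> is
  divisible by \<open>P\<close>, coefficient after coefficient, and \<open>u\<close> is integral at \<open>P\<close>.

  Analysis: the \<open>\<theta>^D\<close>-torsion points of the Carlitz module are bounded, and every \<open>C\<^sub>a\<close> maps torsion
  points to torsion points. If \<open>|F| \<le> c\<close> on them, then \<open>|S\<^sub>d(F)| \<le> c q^-d\<close> and \<open>|T\<^sub>n(F)| \<le> c q^-n < 1\<close> there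
  for large \<open>n\<close>. A polynomial over \<open>A\<close> that is smaller than 1 at all torsion points is zero
  (\<open>poly_over_A_eq_0_if_small\<close>): by Lagrange interpolation its leading coefficient is a combination of its
  values at torsion points, and the weights can be chosen so small that it is an element of \<open>A\<close> of
  absolute value less than 1. The resulting bound on \<open>n\<close> depends only on \<open>c\<close>
  (\<open>L_term_eq_0\<close>), and is therefore uniform in the substitution parameter \<open>k\<close>.

  From vanishing to \<open>A\<close>. The coefficient of \<open>X^(M q^n)\<close> in \<open>T\<^sub>n(F)\<close>, for \<open>M = deg F\<close>, depends only on the
  leading coefficient \<open>f\<close> of \<open>F\<close>, and is \<open>E\<^sub>n(f)\<close> for an additive polynomial \<open>E\<^sub>n\<close> of degree \<open>q^n\<close>
  (\<open>coeff_L_term_top\<close>). The first direction, applied to constants, shows that \<open>E\<^sub>n\<close> vanishes at the \<open>q^n\<close>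
  elements of \<open>A\<close> of degree less than \<open>n\<close>; these are then all its roots, so \<open>E\<^sub>n(f) = 0\<close> forces \<open>f \<in> A\<close>.
  Removing the leading term of \<open>F\<close> preserves the hypothesis, again by the first direction, and induction
  on the degree finishes the proof (\<open>over_A_if_L_term_eventually_0\<close>).
\<close>

section \<open>Powers of \<open>q\<close> in rings of characteristic dividing \<open>q\<close>\<close>

text \<open>
  This condition makes \<open>x \<mapsto> x^q\<close> additive. In terms of binomial coefficients it passes at once from a ring
  to polynomials and power series over it.
\<close>

definition char_power :: "'a::comm_ring_1 itself \<Rightarrow> nat \<Rightarrow> bool" where
  "char_power T q \<longleftrightarrow> 1 < q \<and> (\<forall>k. 0 < k \<and> k < q \<longrightarrow> of_nat (q choose k) = (0::'a))"

lemma char_power_gt_1: "char_power T q \<Longrightarrow> 1 < q"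
  by (simp add: char_power_def)

lemma frob_add:
  fixes x y :: "'a::comm_ring_1"
  assumes "char_power TYPE('a) q"
  shows "(x + y) ^ q = x ^ q + y ^ q"
proof -
  have "(x + y) ^ q = (\<Sum>k\<le>q. of_nat (q choose k) * x ^ k * y ^ (q - k))"
    by (rule binomial_ring)
  also have "\<dots> = (\<Sum>k\<in>{0, q}. of_nat (q choose k) * x ^ k * y ^ (q - k))"
    using assms by (intro sum.mono_neutral_right) (auto simp: char_power_def)
  finally show ?thesis
    using char_power_gt_1[OF assms] by (simp add: add.commute)
qed

lemma frob_pow_add:
  fixes x y :: "'a::comm_ring_1"
  assumes "char_power TYPE('a) q"
  shows "(x + y) ^ (q ^ i) = x ^ (q ^ i) + y ^ (q ^ i)"
proof (induction i)
  case (Suc i)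
  have "(x + y) ^ (q ^ Suc i) = ((x + y) ^ (q ^ i)) ^ q"
    by (simp add: power_mult [symmetric] mult.commute)
  then show ?case
    by (simp add: Suc frob_add[OF assms] power_mult [symmetric] mult.commute)
qed simp

lemma frob_pow_zero: "char_power TYPE('a) q \<Longrightarrow> (0::'a::comm_ring_1) ^ (q ^ i) = 0"
  by (simp add: zero_power char_power_def)

lemma frob_pow_diff:
  fixes x y :: "'a::comm_ring_1"
  assumes "char_power TYPE('a) q"
  shows "(x - y) ^ (q ^ i) = x ^ (q ^ i) - y ^ (q ^ i)"
  using frob_pow_add[OF assms, of "x - y" y i] by simp

lemma frob_pow_sum:
  fixes f :: "'b \<Rightarrow> 'a::comm_ring_1"
  assumes "char_power TYPE('a) q"
  shows "(\<Sum>x\<in>A. f x) ^ (q ^ i) = (\<Sum>x\<in>A. f x ^ (q ^ i))"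
  by (induction A rule: infinite_finite_induct)
    (simp_all add: frob_pow_add[OF assms] frob_pow_zero[OF assms])

lemma char_power_poly:
  "char_power TYPE('a::comm_ring_1) q \<Longrightarrow> char_power TYPE('a poly) q"
  by (simp add: char_power_def of_nat_poly)

lemma char_power_poly_mapping:
  "char_power TYPE('a::comm_ring_1) q \<Longrightarrow> char_power TYPE('b::comm_monoid_add \<Rightarrow>\<^sub>0 'a) q"
  by (simp add: char_power_def flip: single_of_nat)

lemma coeff_frob_pow:
  fixes p :: "'a::comm_ring_1 poly"
  assumes q: "char_power TYPE('a) q"
  shows "coeff (p ^ (q ^ i)) (n * q ^ i) = coeff p n ^ (q ^ i)"
    and "\<not> q ^ i dvd m \<Longrightarrow> coeff (p ^ (q ^ i)) m = 0"
proof -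
  have eq: "p ^ (q ^ i) = (\<Sum>k\<le>degree p. monom (coeff p k ^ (q ^ i)) (k * q ^ i))"
    by (subst poly_as_sum_of_monoms[symmetric])
      (simp add: frob_pow_sum[OF char_power_poly[OF q]] monom_power)
  have q0: "0 < q ^ i"
    using char_power_gt_1[OF q] by simp
  show "coeff (p ^ (q ^ i)) (n * q ^ i) = coeff p n ^ (q ^ i)"
    using q0 by (cases "n \<le> degree p")
     (auto simp: eq coeff_sum coeff_monom coeff_eq_0 frob_pow_zero[OF q] if_distrib cong: if_cong)
  show "coeff (p ^ (q ^ i)) m = 0" if "\<not> q ^ i dvd m"
    unfolding eq coeff_sum by (rule sum.neutral) (use that in auto)
qed

lemma fps_nth_frob_pow:
  fixes G :: "'a::comm_ring_1 fps"
  assumes q: "char_power TYPE('a) q"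
  shows "fps_nth (G ^ (q ^ i)) n = (if q ^ i dvd n then fps_nth G (n div q ^ i) ^ (q ^ i) else 0)"
proof -
  have qf: "char_power TYPE('a fps) q"
    using q by (simp add: char_power_def fps_of_nat [symmetric])
  have q0: "0 < q ^ i"
    using char_power_gt_1[OF q] by simp
  \<comment> \<open>Only finitely many terms of the series matter for one coefficient of its power.\<close>
  define H where "H = fps_shift (Suc n) G"
  have G: "G = (\<Sum>k\<le>n. fps_const (fps_nth G k) * fps_X ^ k) + H * fps_X ^ Suc n"
    by (rule fps_ext) (auto simp: H_def fps_sum_nth fps_X_power_mult_right_nth if_distrib simp del: power_Suc cong: if_cong)
  have "G ^ (q ^ i) = (\<Sum>k\<le>n. fps_const (fps_nth G k ^ (q ^ i)) * fps_X ^ (k * q ^ i))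
      + H ^ (q ^ i) * fps_X ^ (Suc n * q ^ i)"
    by (subst G) (simp only: frob_pow_add[OF qf] frob_pow_sum[OF qf] power_mult_distrib
      power_mult [symmetric] fps_const_power)
  moreover have *: "fps_nth (fps_const c * fps_X ^ m) n = (if n = m then c else 0)" for c :: 'a and m
    by (simp only: fps_mult_left_const_nth fps_X_power_nth) simp
  moreover have "n < Suc n * q ^ i"
    using q0 by (metis Suc_le_lessD mult.commute mult_le_mono1 nat_mult_1 One_nat_def Suc_leI)
  then have "fps_nth (H ^ (q ^ i) * fps_X ^ (Suc n * q ^ i)) n = 0"
    by (simp add: fps_X_power_mult_right_nth del: mult_Suc)
  ultimately have "fps_nth (G ^ (q ^ i)) n = (\<Sum>k\<le>n. if n = k * q ^ i then fps_nth G k ^ (q ^ i) else 0)"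
    by (simp only: fps_sum_nth fps_add_nth add_0_right *)
  also have "\<dots> = (if q ^ i dvd n then fps_nth G (n div q ^ i) ^ (q ^ i) else 0)"
  proof (cases "q ^ i dvd n")
    case True
    then obtain m where m: "n = m * q ^ i" by (metis dvd_def mult.commute)
    have "m * 1 \<le> m * q ^ i"
      by (rule mult_le_mono2) (use q0 in linarith)
    then have "m \<le> n"
      by (simp add: m)
    have "n = k * q ^ i \<longleftrightarrow> k = m" for k
      using q0 unfolding m by (metis mult_right_cancel less_irrefl)
    moreover have "n div q ^ i = m"
      using q0 by (simp only: m div_mult_self_is_m)
    ultimately show ?thesis
      using True \<open>m \<le> n\<close> by simp
  qed (auto intro!: sum.neutral)
  finally show ?thesis .
qed

section \<open>The coefficients of the Carlitz module\<close>

lemma char_power_finite_field: "char_power TYPE('q::{field,finite}) CARD('q)"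
proof -
  have "card {0, 1::'q} \<le> CARD('q)"
    by (rule card_mono) auto
  then show ?thesis
    by (simp add: char_power_def of_nat_card_choose)
qed

abbreviation theta :: "'q::{field,finite} poly" where
  "theta \<equiv> [:0, 1:]"

text \<open>
  All the coefficients of \<open>C\<^sub>a\<close>: as \<open>C\<^sub>a\<close> is additive, other exponents do not occur.
\<close>

definition carlitz_coeff :: "'q::{field,finite} poly \<Rightarrow> nat \<Rightarrow> 'q poly" where
  "carlitz_coeff a k = coeff (carlitz a) (CARD('q) ^ k)"

lemma card_gt_1: "1 < CARD('q::{field,finite})"
  using char_power_gt_1[OF char_power_finite_field[where 'q = 'q]] .

lemma coeff_carlitz_pCons:
  fixes a :: "'q::{field,finite} poly"
  shows "coeff (carlitz (pCons c a)) m =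
    (if m = 1 then [:c:] else 0) + theta * coeff (carlitz a) m + coeff (carlitz a ^ CARD('q)) m"
  by (cases m) (simp_all add: carlitz_pCons pcompose_carlitz_theta coeff_pCons split: nat.split)

lemma coeff_carlitz_eq_0:
  fixes a :: "'q::{field,finite} poly"
  assumes "\<And>k. m \<noteq> CARD('q) ^ k"
  shows "coeff (carlitz a) m = 0"
  using assms
proof (induction a arbitrary: m)
  case (pCons c a)
  have q: "char_power TYPE('q poly) CARD('q)"
    by (intro char_power_poly char_power_finite_field)
  have "coeff (carlitz a ^ CARD('q)) m = 0"
  proof (cases "CARD('q) dvd m")
    case True
    then obtain n where n: "m = n * CARD('q)"
      by (metis dvd_def mult.commute)
    have "n \<noteq> CARD('q) ^ k" for k
      using pCons.prems[of "Suc k"] by (auto simp: n)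
    then have "coeff (carlitz a) n = 0"
      by (rule pCons.IH)
    then show ?thesis
      using coeff_frob_pow(1)[OF q, of "carlitz a" 1 n] by (simp add: n zero_power)
  next
    case False
    then show ?thesis
      using coeff_frob_pow(2)[OF q, of 1 m "carlitz a"] by simp
  qed
  then show ?case
    using pCons.IH[OF pCons.prems] pCons.prems[of 0] by (simp add: coeff_carlitz_pCons)
qed simp

lemma carlitz_coeff_0 [simp]: "carlitz_coeff 0 k = 0"
  by (simp add: carlitz_coeff_def)

lemma carlitz_coeff_pCons_0:
  "carlitz_coeff (pCons c a) 0 = [:c:] + theta * carlitz_coeff a 0"
  for a :: "'q::{field,finite} poly"
  using coeff_frob_pow(2)[OF char_power_poly[OF char_power_finite_field], of 1 1 "carlitz a"]
    card_gt_1[where 'q='q]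
  by (simp add: carlitz_coeff_def coeff_carlitz_pCons)

lemma carlitz_coeff_pCons_Suc:
  "carlitz_coeff (pCons c a) (Suc k) = theta * carlitz_coeff a (Suc k) + carlitz_coeff a k ^ CARD('q)"
  for a :: "'q::{field,finite} poly"
proof -
  have "CARD('q) ^ Suc k \<noteq> 1"
    by (metis less_irrefl one_less_power card_gt_1[where 'q = 'q] zero_less_Suc)
  then show ?thesis
    using coeff_frob_pow(1)[OF char_power_poly[OF char_power_finite_field], of "carlitz a" 1 "CARD('q) ^ k"]
    by (simp add: carlitz_coeff_def coeff_carlitz_pCons mult.commute)
qed

lemma carlitz_coeff_at_0: "carlitz_coeff a 0 = a"
  by (induction a) (simp_all add: carlitz_coeff_pCons_0)

lemma carlitz_coeff_eq_0: "degree a < k \<Longrightarrow> carlitz_coeff a k = 0"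
proof (induction a arbitrary: k)
  case (pCons c a)
  then obtain k' where k: "k = Suc k'"
    by (cases k) auto
  show ?case
  proof (cases "a = 0")
    case False
    then show ?thesis
      using pCons by (simp add: k carlitz_coeff_pCons_Suc zero_power)
  qed (simp add: k carlitz_coeff_pCons_Suc zero_power)
qed simp

lemma carlitz_coeff_degree: "carlitz_coeff a (degree a) = [:lead_coeff a:]"
proof (induction a)
  case (pCons c a)
  show ?case
  proof (cases "a = 0")
    case False
    then show ?thesis
      using pCons
      by (simp add: carlitz_coeff_pCons_Suc carlitz_coeff_eq_0 poly_const_pow finite_field_power_card)
  qed (simp add: carlitz_coeff_pCons_0)
qed simp

lemma carlitz_eq_sum_monom:
  fixes a :: "'q::{field,finite} poly"
  shows "carlitz a = (\<Sum>k\<le>degree a. monom (carlitz_coeff a k) (CARD('q) ^ k))"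
proof (rule poly_eqI)
  fix m
  show "coeff (carlitz a) m = coeff (\<Sum>k\<le>degree a. monom (carlitz_coeff a k) (CARD('q) ^ k)) m"
  proof (cases "\<exists>k. m = CARD('q) ^ k")
    case True
    then obtain k where k: "m = CARD('q) ^ k" ..
    have "(CARD('q) ^ i = CARD('q) ^ k) = (i = k)" for i
      using card_gt_1[where 'q = 'q] by (simp add: power_inject_exp)
    then show ?thesis
      by (auto simp: k coeff_sum carlitz_coeff_eq_0 simp flip: carlitz_coeff_def)
  next
    case False
    then show ?thesis
      by (auto simp: coeff_sum coeff_carlitz_eq_0 intro!: sum.neutral)
  qed
qed

text \<open>
  Comparison of the coefficients of \<open>X^(q^(k+1))\<close> in \<open>C\<^sub>a C\<^sub>\<theta> = C\<^sub>\<theta> C\<^sub>a\<close>. It propagates divisibility by a prime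
  from one coefficient of \<open>C\<^sub>a\<close> to the next.
\<close>

lemma carlitz_coeff_commute:
  fixes a :: "'q::{field,finite} poly"
  shows "carlitz_coeff a (Suc k) * (theta ^ (CARD('q) ^ Suc k) - theta) =
    carlitz_coeff a k ^ CARD('q) - carlitz_coeff a k"
proof (induction a arbitrary: k)
  case (pCons c a)
  let ?q = "CARD('q)" and ?c = "carlitz_coeff a"
  have q: "char_power TYPE('q poly) ?q"
    by (intro char_power_poly char_power_finite_field)
  note frob = frob_add[OF q] frob_pow_diff[OF q, where i = 1, simplified]
  have "carlitz_coeff (pCons c a) (Suc k) * (theta ^ (?q ^ Suc k) - theta) =
      theta * (?c k ^ ?q - ?c k) + ?c k ^ ?q * (theta ^ (?q ^ Suc k) - theta)"
    by (simp only: carlitz_coeff_pCons_Suc pCons.IH[symmetric]) (simp only: algebra_simps)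
  also have "\<dots> = ?c k ^ ?q * theta ^ (?q ^ Suc k) - theta * ?c k"
    by (simp only: algebra_simps)
  also have "\<dots> = carlitz_coeff (pCons c a) k ^ ?q - carlitz_coeff (pCons c a) k"
  proof (cases k)
    case 0
    have "[:c:] ^ ?q = [:c:]"
      by (simp add: poly_const_pow finite_field_power_card)
    then show ?thesis
      unfolding 0 carlitz_coeff_pCons_0 frob power_mult_distrib by (simp add: algebra_simps)
  next
    case (Suc l)
    have "(?c l ^ ?q) ^ ?q - ?c l ^ ?q = (?c l ^ ?q - ?c l) ^ ?q"
      by (simp only: frob)
    also have "\<dots> = ?c k ^ ?q * (theta ^ (?q ^ Suc k) - theta ^ ?q)"
      unfolding Suc pCons.IH[symmetric] power_mult_distrib frob
      by (simp only: power_mult [symmetric] power_Suc mult.commute mult.left_commute)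
    finally show ?thesis
      unfolding Suc carlitz_coeff_pCons_Suc frob power_mult_distrib by (simp only: algebra_simps)
  qed
  finally show ?case .
qed (simp add: zero_power)

section \<open>Arithmetic of \<open>A\<close> modulo a prime\<close>

text \<open>
  The representatives of the residues modulo a polynomial of degree \<open>n\<close>. The condition is on coefficients
  because \<open>degree a < n\<close> would be wrong for \<open>n = 0\<close>.
\<close>

definition polys_lt :: "nat \<Rightarrow> 'a::zero poly set" where
  "polys_lt n = {a. \<forall>k\<ge>n. coeff a k = 0}"

lemma mem_polys_lt_iff: "0 < n \<Longrightarrow> a \<in> polys_lt n \<longleftrightarrow> degree a < n"
  by (auto simp: polys_lt_def coeff_eq_0 intro: le_degree) (metis le_degree leading_coeff_0_iff degree_0 not_le)

lemma card_polys_lt: "finite (polys_lt n :: 'a::{zero,finite} poly set) \<and>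
   card (polys_lt n :: 'a poly set) = CARD('a) ^ n"
proof (induction n)
  case 0
  have "polys_lt 0 = {0::'a poly}"
    by (auto simp: polys_lt_def poly_eq_iff)
  then show ?case by simp
next
  case (Suc n)
  have eq: "polys_lt (Suc n) = (\<lambda>(c, a). pCons c a) ` (UNIV \<times> polys_lt n :: ('a \<times> 'a poly) set)"
  proof (intro equalityI subsetI)
    fix a :: "'a poly" assume a: "a \<in> polys_lt (Suc n)"
    obtain c b where "a = pCons c b" by (cases a)
    moreover from this a have "b \<in> polys_lt n"
      by (auto simp: polys_lt_def coeff_pCons split: nat.splits)
    ultimately show "a \<in> (\<lambda>(c, a). pCons c a) ` (UNIV \<times> polys_lt n)" by auto
  qed (auto simp: polys_lt_def coeff_pCons split: nat.splits)
  have "inj (\<lambda>(c, a). pCons c a :: 'a poly)"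
    by (auto simp: inj_def)
  then have "card (polys_lt (Suc n) :: 'a poly set) = card (UNIV \<times> polys_lt n :: ('a \<times> 'a poly) set)"
    unfolding eq by (intro card_image) (auto intro: inj_on_subset)
  then show ?case
    using Suc by (simp add: card_cartesian_product eq)
qed

lemma theta_frob_dvd:
  fixes a :: "'q::{field,finite} poly"
  shows "theta ^ (CARD('q) ^ k) - theta dvd a ^ (CARD('q) ^ k) - a"
proof (induction a)
  case (pCons c a)
  let ?Q = "CARD('q) ^ k"
  have q: "char_power TYPE('q poly) CARD('q)"
    by (intro char_power_poly char_power_finite_field)
  have c: "c ^ ?Q = c"
    by (induction k) (simp_all add: power_mult finite_field_power_card)
  have "pCons c a = [:c:] + theta * a"
    by simp
  then have "pCons c a ^ ?Q - pCons c a = theta ^ ?Q * (a ^ ?Q - a) + a * (theta ^ ?Q - theta)"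
    by (simp only: frob_pow_add[OF q] power_mult_distrib poly_const_pow c) (simp add: algebra_simps)
  then show ?case
    using pCons.IH by simp
qed (simp add: zero_power)

text \<open>
  The bound on the number of roots over the residue field of \<open>P\<close>, with residues given by representatives.
\<close>

lemma card_roots_mod_le_degree:
  fixes f :: "'a::idom poly"
  assumes P: "prime_elem P" and "finite S" "lead_coeff f = 1" "\<And>s. s \<in> S \<Longrightarrow> P dvd poly f s"
    and "\<And>s t. s \<in> S \<Longrightarrow> t \<in> S \<Longrightarrow> P dvd t - s \<Longrightarrow> t = s"
  shows "card S \<le> degree f"
  using assms(2-)
proof (induction "degree f" arbitrary: f S)
  case 0
  then have "f = 1"
    by (metis degree_0_id lead_coeff_pCons one_pCons degree_eq_zeroE lead_coeff_pCons(2))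
  then show ?case
    using P 0 by (cases "S = {}") (auto simp: prime_elem_def)
next
  case (Suc n)
  show ?case
  proof (cases "S = {}")
    case False
    then obtain s where s: "s \<in> S" by auto
    define g where "g = synthetic_div f s"
    have f: "f = [:-s, 1:] * g + [:poly f s:]"
      using synthetic_div_correct'[of s f] by (simp add: g_def)
    have dg: "degree g = n"
      using Suc.hyps by (simp add: g_def degree_synthetic_div)
    have "coeff f (Suc n) = lead_coeff g"
      by (subst f) (simp add: coeff_eq_0 dg)
    then have lg: "lead_coeff g = 1"
      using Suc by simp
    have "P dvd poly g t" if t: "t \<in> S - {s}" for t
    proof -
      have "poly f t = (t - s) * poly g t + poly f s"
        by (subst f) (simp add: algebra_simps)
      then have "P dvd (t - s) * poly g t"
        using Suc.prems(3) s t by (metis DiffD1 dvd_add_left_iff)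
      then show ?thesis
        using Suc.prems(4)[OF s] t P by (auto dest!: prime_elem_dvd_multD)
    qed
    then have "card (S - {s}) \<le> degree g"
      using Suc.prems Suc.hyps(1)[of g "S - {s}"] lg dg by auto
    then show ?thesis
      using s Suc.hyps(2) Suc.prems(1) dg by simp
  qed simp
qed

text \<open>
  If \<open>\<theta>\<close> is fixed by the power \<open>q^k\<close> modulo \<open>P\<close>, then so are all \<open>q^(deg P)\<close> residues, which are then roots of
  a polynomial of degree \<open>q^k\<close>.
\<close>

lemma degree_le_if_dvd_theta_frob:
  fixes P :: "'q::{field,finite} poly"
  assumes P: "prime_elem P" and "P dvd theta ^ (CARD('q) ^ k) - theta" and k: "0 < k"
  shows "degree P \<le> k"
proof -
  let ?Q = "CARD('q) ^ k"
  define f :: "'q poly poly" where "f = monom 1 ?Q - monom 1 1"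
  have Q: "1 < ?Q"
    using k by (intro one_less_power card_gt_1)
  have "P \<noteq> 0" "\<not> P dvd 1"
    using P by (auto simp: prime_elem_def)
  then have dP: "0 < degree P"
    by (metis is_unit_iff_degree gr0I)
  have df: "degree f = ?Q"
    using Q by (intro antisym degree_le le_degree) (auto simp: f_def coeff_monom)
  have "card (polys_lt (degree P) :: 'q poly set) \<le> degree f"
  proof (rule card_roots_mod_le_degree[OF P])
    show "finite (polys_lt (degree P) :: 'q poly set)"
      using card_polys_lt by auto
    show "lead_coeff f = 1"
      unfolding df using Q by (simp add: f_def)
    show "P dvd poly f s" for s
      using theta_frob_dvd[of k s] assms(2) by (auto simp: f_def poly_monom intro: dvd_trans)
    show "t = s" if "s \<in> polys_lt (degree P)" "t \<in> polys_lt (degree P)" "P dvd t - s" for s t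
    proof (rule ccontr)
      assume "t \<noteq> s"
      then have "degree P \<le> degree (t - s)"
        using that(3) by (intro dvd_imp_degree_le) auto
      moreover have "degree (t - s) < degree P"
        using that(1,2) dP by (intro degree_diff_less) (auto simp: mem_polys_lt_iff)
      ultimately show False by simp
    qed
  qed
  then have "CARD('q) ^ degree P \<le> CARD('q) ^ k"
    using card_polys_lt[where 'a = 'q] by (simp add: df)
  then show ?thesis
    by (rule power_le_imp_le_exp[OF card_gt_1])
qed

text \<open>
  The coefficient with index 0 is \<open>P\<close> itself. By \<open>carlitz_coeff_commute\<close> the divisibility is passed on as
  long as \<open>P\<close> does not divide the factor \<open>\<theta>^(q^(k+1)) - \<theta>\<close>, that is, below the degree of \<open>P\<close>.
\<close>

lemma prime_dvd_carlitz_coeff: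
  fixes P :: "'q::{field,finite} poly"
  assumes P: "prime_elem P" and "k < degree P"
  shows "P dvd carlitz_coeff P k"
  using assms(2)
proof (induction k)
  case (Suc k)
  then have "P dvd carlitz_coeff P k ^ CARD('q) - carlitz_coeff P k"
    by (intro dvd_diff dvd_power) (auto intro: dvd_trans[OF _ dvd_power])
  then have "P dvd carlitz_coeff P (Suc k) * (theta ^ (CARD('q) ^ Suc k) - theta)"
    by (simp only: carlitz_coeff_commute)
  moreover have "\<not> P dvd theta ^ (CARD('q) ^ Suc k) - theta"
    using degree_le_if_dvd_theta_frob[OF P, of "Suc k"] Suc.prems by (auto simp del: power_Suc)
  ultimately show ?case
    using prime_elem_dvd_multD[OF P] by blast
qed (simp add: carlitz_coeff_at_0)

text \<open>
  The next step of the same recursion: the coefficient with index \<open>deg P\<close> is a unit, so that \<open>P\<close> must divide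
  the other factor.
\<close>

lemma prime_dvd_theta_frob:
  fixes P :: "'q::{field,finite} poly"
  assumes P: "prime_elem P"
  shows "P dvd theta ^ (CARD('q) ^ degree P) - theta"
proof -
  have "P \<noteq> 0" "\<not> P dvd 1"
    using P by (auto simp: prime_elem_def)
  then obtain k where k: "degree P = Suc k"
    by (metis is_unit_iff_degree old.nat.exhaust)
  have "P dvd carlitz_coeff P k"
    using P k by (intro prime_dvd_carlitz_coeff) auto
  then have "P dvd carlitz_coeff P k ^ CARD('q) - carlitz_coeff P k"
    by (intro dvd_diff) (auto intro: dvd_trans[OF _ dvd_power])
  then have "P dvd carlitz_coeff P (degree P) * (theta ^ (CARD('q) ^ degree P) - theta)"
    unfolding k by (simp only: carlitz_coeff_commute)
  moreover have "\<not> P dvd carlitz_coeff P (degree P)"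
    using \<open>P \<noteq> 0\<close> \<open>\<not> P dvd 1\<close>
    by (metis carlitz_coeff_degree dvd_trans is_unit_triv leading_coeff_0_iff)
  ultimately show ?thesis
    using prime_elem_dvd_multD[OF P] by blast
qed

text \<open>
  In characteristic \<open>p\<close> the polynomial \<open>\<theta>^(q^k) - \<theta>\<close> has derivative \<open>-1\<close>, so it is squarefree.
\<close>

lemma prime_square_not_dvd_theta_frob:
  fixes P :: "'q::{field,finite} poly"
  assumes P: "prime_elem P" and k: "0 < k"
  shows "\<not> P * P dvd theta ^ (CARD('q) ^ k) - theta"
proof
  assume "P * P dvd theta ^ (CARD('q) ^ k) - theta"
  then obtain g where g: "theta ^ (CARD('q) ^ k) - theta = P * P * g" ..
  have "of_nat CARD('q) = (0::'q)"
    using of_nat_card_choose[of 1, where 'q = 'q] card_gt_1[where 'q = 'q] by simp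
  then have "of_nat (CARD('q) ^ k) = (0::'q poly)"
    using k by (simp add: of_nat_poly zero_power)
  then have "pderiv (theta ^ (CARD('q) ^ k) - theta) = (-1 :: 'q poly)"
    by (simp add: pderiv_diff pderiv_power pderiv_pCons of_nat_poly zero_power one_pCons)
  moreover have "P dvd pderiv (P * P * g)"
    by (simp add: pderiv_mult)
  ultimately have "P dvd -1"
    by (simp add: g)
  then show False
    using P by (auto simp: prime_elem_def)
qed

text \<open>
  The exponent of \<open>P\<close> in \<open>D\<^sub>i\<^sub>+\<^sub>1\<close> is at most \<open>q\<close> times that in \<open>D\<^sub>i\<close>, plus 1. The strict bound leaves one factor
  \<open>P\<close> in \<open>P^(q^i) / D\<^sub>i\<close>, which is why \<open>exp\<^sub>C(P g)\<close> vanishes modulo \<open>P\<close> for integral \<open>g\<close>.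
\<close>

lemma carlitz_D_prime_part:
  fixes P :: "'q::{field,finite} poly"
  assumes P: "prime_elem P"
  shows "\<exists>k b. carlitz_D i = P ^ k * b \<and> \<not> P dvd b \<and> k < CARD('q) ^ i"
proof (induction i)
  case 0
  then show ?case
    using P by (intro exI[of _ 0] exI[of _ 1]) (auto simp: prime_elem_def)
next
  case (Suc i)
  let ?q = "CARD('q)"
  obtain k b where kb: "carlitz_D i = P ^ k * b" "\<not> P dvd b" "k < ?q ^ i"
    using Suc by auto
  define t :: "'q poly" where "t = theta ^ (?q ^ Suc i) - theta"
  have "\<exists>l c. t = P ^ l * c \<and> \<not> P dvd c \<and> l \<le> 1"
  proof (cases "P dvd t")
    case True
    then obtain c where c: "t = P * c" ..
    then have "\<not> P dvd c"
      using prime_square_not_dvd_theta_frob[OF P, of "Suc i"]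
      by (auto simp: t_def mult.assoc simp del: power_Suc)
    then show ?thesis
      using c by (intro exI[of _ 1] exI[of _ c]) auto
  qed (intro exI[of _ 0] exI[of _ t], auto)
  then obtain l c where lc: "t = P ^ l * c" "\<not> P dvd c" "l \<le> 1"
    by auto
  have "carlitz_D (Suc i) = P ^ (l + k * ?q) * (c * b ^ ?q)"
    using lc(1) by (simp add: kb(1) t_def power_add power_mult power_mult_distrib ac_simps)
  moreover have "\<not> P dvd c * b ^ ?q"
    using lc(2) kb(2) by (auto dest!: prime_elem_dvd_multD[OF P] prime_elem_dvd_power[OF P])
  moreover have "l + k * ?q < ?q ^ Suc i"
  proof -
    have "Suc k * ?q \<le> ?q ^ i * ?q"
      using kb(3) by (intro mult_le_mono1) simp
    then show ?thesis
      using lc(3) card_gt_1[where 'q = 'q] by (simp add: mult.commute)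
  qed
  ultimately show ?case by blast
qed

lemma theta_power:
  shows "degree (theta ^ D :: 'q::{field,finite} poly) = D" and "lead_coeff (theta ^ D :: 'q poly) = 1"
proof -
  show "degree (theta ^ D :: 'q poly) = D"
    by (simp add: degree_power_eq)
  show "lead_coeff (theta ^ D :: 'q poly) = 1"
    unfolding lead_coeff_power by simp
qed

lemma carlitz_D_nonzero: "carlitz_D i \<noteq> (0 :: 'q::{field,finite} poly)"
proof (induction i)
  case (Suc i)
  have "coeff (theta ^ (CARD('q) ^ Suc i)) 1 = (0::'q)"
  proof -
    have "CARD('q) ^ Suc i \<noteq> 1"
      by (metis less_irrefl one_less_power card_gt_1[where 'q = 'q] zero_less_Suc)
    then show ?thesis
      by (simp add: monom_altdef[of 1, simplified, symmetric] del: power_Suc)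
  qed
  then have "theta ^ (CARD('q) ^ Suc i) \<noteq> (theta :: 'q poly)"
    by (metis coeff_pCons_Suc One_nat_def coeff_pCons_0 one_pCons zero_neq_one)
  then show ?case
    using Suc by simp
qed simp

lemma degree_carlitz_D: "degree (carlitz_D i :: 'q::{field,finite} poly) = i * CARD('q) ^ i"
proof (induction i)
  case (Suc i)
  have "1 < CARD('q) ^ Suc i"
    using one_less_power[OF card_gt_1[where 'q = 'q], of "Suc i"] by simp
  then have deg: "degree (theta ^ (CARD('q) ^ Suc i) - theta :: 'q poly) = CARD('q) ^ Suc i"
    using degree_add_eq_left[of "- theta :: 'q poly" "theta ^ (CARD('q) ^ Suc i)"]
    by (simp add: degree_power_eq diff_conv_add_uminus del: power_Suc add_uminus_conv_diff)
  have "theta ^ (CARD('q) ^ Suc i) - theta \<noteq> (0 :: 'q poly)"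
    using carlitz_D_nonzero[of "Suc i", where 'q = 'q] by auto
  then have "degree (carlitz_D (Suc i) :: 'q poly) = CARD('q) ^ Suc i + CARD('q) * (i * CARD('q) ^ i)"
    using carlitz_D_nonzero[of i, where 'q = 'q]
    by (simp add: degree_mult_eq deg degree_power_eq Suc del: power_Suc)
  then show ?case
    by (simp add: algebra_simps)
qed simp

lemma prime_degree_pos:
  fixes P :: "'q::field poly"
  assumes "prime_elem P"
  shows "0 < degree P"
proof -
  have "P \<noteq> 0" "\<not> is_unit P"
    using assms by (auto simp: prime_elem_def)
  then show ?thesis
    by (auto simp: is_unit_iff_degree)
qed

text \<open>
  A nonconstant divisor of least degree is irreducible.
\<close>

lemma monic_prime_divisor:
  fixes b :: "'q::field poly"
  assumes "0 < degree b"
  obtains P where "prime_elem P" "lead_coeff P = 1" "P dvd b"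
proof -
  define S where "S = {p. p dvd b \<and> 0 < degree p}"
  have b: "b \<in> S"
    using assms by (simp add: S_def)
  define p where "p = arg_min degree (\<lambda>p. p \<in> S)"
  have p: "p \<in> S"
    unfolding p_def using b by (rule arg_min_natI)
  have min: "degree p \<le> degree x" if "x \<in> S" for x
    unfolding p_def using that by (rule arg_min_nat_le)
  define P where "P = smult (inverse (lead_coeff p)) p"
  have p0: "p \<noteq> 0"
    using p by (auto simp: S_def)
  have "irreducible p"
  proof (rule irreducibleI)
    show "p \<noteq> 0" "\<not> is_unit p"
      using p p0 by (auto simp: S_def is_unit_iff_degree)
    show "x dvd 1 \<or> y dvd 1" if xy: "p = x * y" for x y
    proof (rule ccontr)
      assume c: "\<not> (x dvd 1 \<or> y dvd 1)"
      have xy0: "x \<noteq> 0" "y \<noteq> 0"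
        using p0 xy by auto
      have "x \<in> S"
        using c xy xy0 p by (auto simp: S_def is_unit_iff_degree intro: dvd_mult_left)
      then have "degree p \<le> degree x"
        by (rule min)
      then show False
        using c xy xy0 by (simp add: degree_mult_eq is_unit_iff_degree)
    qed
  qed
  then have "prime_elem p"
    by (rule field_poly_irreducible_imp_prime)
  moreover have "is_unit [:inverse (lead_coeff p):]" "P = [:inverse (lead_coeff p):] * p"
    using p0 by (auto simp: P_def is_unit_const_poly_iff dvd_field_iff)
  ultimately have "prime_elem P"
    by (simp only: prime_elem_mult_unit_left)
  moreover have "P dvd p"
    using p0 by (auto simp: P_def smult_dvd_iff)
  moreover have "lead_coeff P = 1"
    using p0 by (simp add: P_def)
  moreover have "P dvd b"
    using \<open>P dvd p\<close> p by (auto simp: S_def intro: dvd_trans)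
  ultimately show ?thesis
    using that by blast
qed

lemma A_plus_prime_multiples:
  fixes P :: "'q::field poly"
  assumes lc: "lead_coeff P = 1"
  shows "{a \<in> A_plus d. P dvd a} = (if d < degree P then {} else (*) P ` A_plus (d - degree P))"
proof -
  have P0: "P \<noteq> 0"
    using lc by auto
  have "P * b \<in> A_plus d \<longleftrightarrow> degree P \<le> d \<and> b \<in> A_plus (d - degree P)" for b
  proof (cases "b = 0")
    case False
    then show ?thesis
      unfolding A_plus_def mem_Collect_eq lead_coeff_mult lc using P0 by (auto simp: degree_mult_eq)
  qed (simp add: A_plus_def)
  then show ?thesis
    by (auto simp: dvd_def)
qed

section \<open>Polynomials with coefficients in a subring or an ideal\<close>

lemma smult_sum_right: "smult x (\<Sum>i\<in>S. f i) = (\<Sum>i\<in>S. smult x (f i))"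
  by (induction S rule: infinite_finite_induct) (simp_all add: smult_add_right)

text \<open>
  Rings and ideals are subsets of the ambient ring: below, \<open>A\<close>, its localization at a prime and the maximal
  ideal there all lie in one field.
\<close>

definition submodule_of :: "'a::comm_ring_1 set \<Rightarrow> 'a set \<Rightarrow> bool" where
  "submodule_of R I \<longleftrightarrow> 0 \<in> I \<and> (\<forall>x\<in>I. \<forall>y\<in>I. x - y \<in> I) \<and> (\<forall>r\<in>R. \<forall>x\<in>I. r * x \<in> I)"

definition polys_over :: "'a::zero set \<Rightarrow> 'a poly set" where
  "polys_over R = {p. \<forall>n. coeff p n \<in> R}"

lemma polys_over_pConsD: "pCons c f \<in> polys_over R \<Longrightarrow> c \<in> R \<and> f \<in> polys_over R"
  unfolding polys_over_def by (auto dest: spec[of _ 0]) (metis coeff_pCons_Suc)+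

lemma polys_over_mono: "R \<subseteq> R' \<Longrightarrow> polys_over R \<subseteq> polys_over R'"
  by (auto simp: polys_over_def)

lemma pcompose_power: "pcompose (p ^ n) r = pcompose p r ^ n"
  by (induction n) (simp_all add: pcompose_1 pcompose_mult)

context
  fixes R I :: "'a::comm_ring_1 set"
  assumes RI: "submodule_of R I"
begin

lemma submodule_0: "0 \<in> I" and submodule_diff: "x \<in> I \<Longrightarrow> y \<in> I \<Longrightarrow> x - y \<in> I"
  and submodule_mult: "r \<in> R \<Longrightarrow> x \<in> I \<Longrightarrow> r * x \<in> I"
  using RI by (auto simp: submodule_of_def)

lemma submodule_add: "x \<in> I \<Longrightarrow> y \<in> I \<Longrightarrow> x + y \<in> I"
  using submodule_diff[OF _ submodule_diff[OF submodule_0, of y], of x] by simp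

lemma submodule_sum: "(\<And>x. x \<in> A \<Longrightarrow> f x \<in> I) \<Longrightarrow> sum f A \<in> I"
  by (induction A rule: infinite_finite_induct) (auto intro: submodule_0 submodule_add)

lemma polys_over_0: "0 \<in> polys_over I"
  by (simp add: polys_over_def submodule_0)

lemma polys_over_const: "c \<in> I \<Longrightarrow> [:c:] \<in> polys_over I"
  by (auto simp: polys_over_def coeff_pCons submodule_0 split: nat.split)

lemma polys_over_diff: "p \<in> polys_over I \<Longrightarrow> r \<in> polys_over I \<Longrightarrow> p - r \<in> polys_over I"
  by (simp add: polys_over_def submodule_diff)

lemma polys_over_add: "p \<in> polys_over I \<Longrightarrow> r \<in> polys_over I \<Longrightarrow> p + r \<in> polys_over I"
  by (simp add: polys_over_def submodule_add)

lemma polys_over_sum: "(\<And>x. x \<in> A \<Longrightarrow> f x \<in> polys_over I) \<Longrightarrow> sum f A \<in> polys_over I"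
  by (induction A rule: infinite_finite_induct) (auto intro: polys_over_0 polys_over_add)

lemma polys_over_mult: "p \<in> polys_over R \<Longrightarrow> r \<in> polys_over I \<Longrightarrow> p * r \<in> polys_over I"
  by (auto simp: polys_over_def coeff_mult intro!: submodule_sum submodule_mult)

lemma polys_over_smult: "c \<in> R \<Longrightarrow> p \<in> polys_over I \<Longrightarrow> smult c p \<in> polys_over I"
  by (auto simp: polys_over_def submodule_mult)

lemma polys_over_smult_ideal: "c \<in> I \<Longrightarrow> p \<in> polys_over R \<Longrightarrow> smult c p \<in> polys_over I"
  using submodule_mult by (auto simp: polys_over_def mult.commute[of c])

lemma polys_over_pcompose: "p \<in> polys_over I \<Longrightarrow> r \<in> polys_over R \<Longrightarrow> pcompose p r \<in> polys_over I"
proof (induction p)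
  case (pCons c p)
  then have "c \<in> I" "p \<in> polys_over I"
    unfolding polys_over_def by (auto dest: spec[of _ 0]) (metis coeff_pCons_Suc)+
  then show ?case
    using pCons by (auto simp: pcompose_pCons intro!: polys_over_add polys_over_mult polys_over_const)
qed (simp add: polys_over_0)

end

definition is_subring :: "'a::comm_ring_1 set \<Rightarrow> bool" where
  "is_subring R \<longleftrightarrow> 1 \<in> R \<and> submodule_of R R"

lemma is_subring_self: "is_subring R \<Longrightarrow> submodule_of R R"
  and is_subring_1: "is_subring R \<Longrightarrow> 1 \<in> R"
  by (simp_all add: is_subring_def)

lemma polys_over_power: "is_subring R \<Longrightarrow> p \<in> polys_over R \<Longrightarrow> p ^ n \<in> polys_over R"
  using polys_over_const[of R R 1]
  by (induction n) (auto simp: is_subring_def one_pCons intro: polys_over_mult)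

section \<open>The Carlitz exponential over a field containing \<open>A\<close>\<close>

text \<open>
  The integrality of the coefficients of \<open>L(F, Z)\<close> involves no absolute value, only an embedding of \<open>A\<close>.
\<close>

locale A_algebra =
  fixes em :: "'q::{field,finite} poly \<Rightarrow> 'c::field"
  assumes em_1 [simp]: "em 1 = 1"
    and em_add: "em (a + b) = em a + em b"
    and em_mult: "em (a * b) = em a * em b"
    and em_eq_0D: "em a = 0 \<Longrightarrow> a = 0"
begin

lemma em_0 [simp]: "em 0 = 0"
  using em_add[of 0 0] by (metis add_0 add_cancel_right_right)

lemma em_eq_0_iff [simp]: "em a = 0 \<longleftrightarrow> a = 0"
  using em_eq_0D by auto

lemma em_diff: "em (a - b) = em a - em b"
  using em_add[of "a - b" b] by simp

lemma em_eq_iff [simp]: "em a = em b \<longleftrightarrow> a = b"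
  using em_eq_0_iff[of "a - b"] by (simp only: em_diff) simp

lemma em_power: "em (a ^ n) = em a ^ n"
  by (induction n) (simp_all add: em_mult)

lemma em_sum: "em (\<Sum>x\<in>S. f x) = (\<Sum>x\<in>S. em (f x))"
  by (induction S rule: infinite_finite_induct) (simp_all add: em_add)

lemma em_of_nat: "em (of_nat n) = of_nat n"
  by (induction n) (simp_all add: em_add)

lemma char_power_em: "char_power TYPE('c) CARD('q)"
  using char_power_poly[OF char_power_finite_field[where 'q = 'q]] em_of_nat
  by (auto simp: char_power_def) (metis em_0)

lemmas frob_p = char_power_poly[OF char_power_em]
lemmas frob_p_sum = frob_pow_sum[OF frob_p, where i = 1, simplified]

lemma em_const_frob: "em [:c:] ^ (CARD('q) ^ i) = em [:c:]"
proof (induction i)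
  case (Suc i)
  have "em [:c:] ^ CARD('q) = em [:c:]"
    by (simp add: poly_const_pow finite_field_power_card flip: em_power)
  then show ?case
    using Suc by (simp add: power_mult)
qed simp

lemma map_poly_em_add: "map_poly em (f + g) = map_poly em f + map_poly em g"
  by (rule poly_eqI) (simp add: coeff_map_poly em_add)

lemma map_poly_em_mult: "map_poly em (f * g) = map_poly em f * map_poly em g"
  by (rule poly_eqI) (simp add: coeff_map_poly coeff_mult em_sum em_mult)

lemma map_poly_em_pcompose: "map_poly em (pcompose f g) = pcompose (map_poly em f) (map_poly em g)"
  by (induction f) (simp_all add: pcompose_pCons map_poly_em_add map_poly_em_mult map_poly_pCons)

lemma subring_A: "is_subring (range em)"
  by (auto simp: is_subring_def submodule_of_def simp flip: em_1 em_diff em_mult em_0)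

definition carlitz_em :: "'q poly \<Rightarrow> 'c poly" where
  "carlitz_em a = map_poly em (carlitz a)"

text \<open>
  The sum \<open>S\<^sub>d(F)\<close>, for \<open>F\<close> in one variable.
\<close>

definition twisted_sum :: "'c poly \<Rightarrow> nat \<Rightarrow> 'c poly" where
  "twisted_sum F d = (\<Sum>a\<in>A_plus d. smult (inverse (em a)) (pcompose F (carlitz_em a)))"

text \<open>
  The coefficient of \<open>Z^(q^n)\<close> in \<open>exp\<^sub>C(\<Sum> h\<^sub>d Z^(q^d))\<close>; a series in which only these powers of \<open>Z\<close> occur
  is represented by its sequence of coefficients.
\<close>

definition exp_coeff :: "(nat \<Rightarrow> 'c poly) \<Rightarrow> nat \<Rightarrow> 'c poly" where
  "exp_coeff h n = (\<Sum>i\<le>n. smult (inverse (em (carlitz_D i))) (h (n - i) ^ (CARD('q) ^ i)))"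

text \<open>
  The coefficient \<open>T\<^sub>n(F)\<close> of \<open>Z^(q^n)\<close> in \<open>L(F, Z)\<close>, for \<open>F\<close> in one variable.
\<close>

definition L_term :: "'c poly \<Rightarrow> nat \<Rightarrow> 'c poly" where
  "L_term F = exp_coeff (twisted_sum F)"

lemma carlitz_em_mult: "carlitz_em (a * b) = pcompose (carlitz_em a) (carlitz_em b)"
  by (simp add: carlitz_em_def carlitz_mult map_poly_em_pcompose)

lemma carlitz_em_commute: "pcompose (carlitz_em a) (carlitz_em b) = pcompose (carlitz_em b) (carlitz_em a)"
  by (metis carlitz_em_mult mult.commute)

lemma carlitz_em_eq_sum: "carlitz_em a = (\<Sum>k\<le>degree a. monom (em (carlitz_coeff a k)) (CARD('q) ^ k))"
proof -
  have "map_poly em (\<Sum>x\<in>S. f x) = (\<Sum>x\<in>S. map_poly em (f x))" for f :: "nat \<Rightarrow> 'q poly poly" and S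
    by (induction S rule: infinite_finite_induct) (simp_all add: map_poly_em_add)
  then show ?thesis
    unfolding carlitz_em_def by (subst carlitz_eq_sum_monom) (simp add: map_poly_monom)
qed

lemma exp_coeff_add: "exp_coeff (\<lambda>d. h d + g d) n = exp_coeff h n + exp_coeff g n"
  by (simp add: exp_coeff_def frob_pow_add[OF frob_p] smult_add_right sum.distrib)

lemma exp_coeff_const: "exp_coeff (\<lambda>d. smult (em [:c:]) (h d)) n = smult (em [:c:]) (exp_coeff h n)"
  by (simp add: exp_coeff_def smult_sum_right smult_power em_const_frob mult.commute)

text \<open>
  The functional equation \<open>exp\<^sub>C(\<theta> G) = \<theta> exp\<^sub>C(G) + exp\<^sub>C(G)^q\<close>. It holds because
  \<open>D\<^sub>i\<^sub>+\<^sub>1 = (\<theta>^(q^(i+1)) - \<theta>) D\<^sub>i^q\<close>.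
\<close>

lemma exp_coeff_theta:
  "exp_coeff (\<lambda>d. smult (em theta) (h d)) n =
    smult (em theta) (exp_coeff h n) + (if n = 0 then 0 else exp_coeff h (n - 1) ^ CARD('q))"
proof -
  define D where "D i = em (carlitz_D i :: 'q poly)" for i
  have "exp_coeff (\<lambda>d. smult (em theta) (h d)) n - smult (em theta) (exp_coeff h n) =
      (\<Sum>i\<le>n. smult (inverse (D i) * (em theta ^ (CARD('q) ^ i) - em theta)) (h (n - i) ^ (CARD('q) ^ i)))"
    by (simp add: exp_coeff_def smult_sum_right D_def smult_power algebra_simps smult_diff_left
        flip: sum_subtractf)
  also have "\<dots> = (if n = 0 then 0 else exp_coeff h (n - 1) ^ CARD('q))"
  proof (cases n)
    case (Suc m)
    have D: "inverse (D (Suc i)) * (em theta ^ (CARD('q) ^ Suc i) - em theta) = inverse (D i) ^ CARD('q)" for i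
    proof -
      have "D (Suc i) = (em theta ^ (CARD('q) ^ Suc i) - em theta) * D i ^ CARD('q)"
        by (simp add: D_def em_mult em_diff em_power)
      moreover have "D (Suc i) \<noteq> 0"
        unfolding D_def using carlitz_D_nonzero em_eq_0_iff by blast
      moreover have "inverse (t * x) * t = inverse x" if "t * x \<noteq> 0" for t x :: 'c
        using that by (simp add: field_simps)
      ultimately show ?thesis
        by (simp only: power_inverse)
    qed
    have "(\<Sum>i\<le>n. smult (inverse (D i) * (em theta ^ (CARD('q) ^ i) - em theta)) (h (n - i) ^ (CARD('q) ^ i)))
        = (\<Sum>i\<le>m. smult (inverse (D i) ^ CARD('q)) (h (m - i) ^ (CARD('q) ^ Suc i)))"
      unfolding Suc by (subst sum.atMost_Suc_shift) (simp del: power_Suc add: D)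
    also have "\<dots> = exp_coeff h m ^ CARD('q)"
      by (simp add: frob_p_sum exp_coeff_def D_def smult_power power_mult[symmetric] mult.commute)
    finally show ?thesis
      by (simp add: Suc)
  qed simp
  finally show ?thesis
    by (simp add: algebra_simps)
qed

text \<open>
  The identity \<open>exp\<^sub>C(a G) = C\<^sub>a(exp\<^sub>C(G))\<close>, which follows from the case \<open>a = \<theta>\<close> by Horner's scheme.
\<close>

lemma exp_coeff_carlitz:
  "exp_coeff (\<lambda>d. smult (em a) (h d)) n =
    (\<Sum>k\<le>n. smult (em (carlitz_coeff a k)) (exp_coeff h (n - k) ^ (CARD('q) ^ k)))"
proof (induction a arbitrary: n)
  case 0
  then show ?case
    by (simp add: exp_coeff_def frob_pow_zero[OF frob_p])
next
  case (pCons c a)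
  let ?u = "exp_coeff h" and ?c = "carlitz_coeff a"
  have "pCons c a = [:c:] + theta * a"
    by simp
  then have em: "em (pCons c a) = em [:c:] + em theta * em a"
    by (simp only: em_add em_mult)
  have c0: "em (carlitz_coeff (pCons c a) 0) = em [:c:] + em theta * em (?c 0)"
    by (simp only: carlitz_coeff_pCons_0 em_add em_mult)
  have cS: "em (carlitz_coeff (pCons c a) (Suc k)) = em theta * em (?c (Suc k)) + em (?c k) ^ CARD('q)" for k
    by (simp only: carlitz_coeff_pCons_Suc em_add em_mult em_power)
  have "exp_coeff (\<lambda>d. smult (em (pCons c a)) (h d)) n =
      smult (em [:c:]) (?u n) + exp_coeff (\<lambda>d. smult (em theta) (smult (em a) (h d))) n"
    unfolding em smult_add_left smult_smult[symmetric] by (simp only: exp_coeff_add exp_coeff_const)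
  also have "\<dots> = smult (em [:c:]) (?u n)
      + (smult (em theta) (\<Sum>k\<le>n. smult (em (?c k)) (?u (n - k) ^ (CARD('q) ^ k)))
      + (if n = 0 then 0 else (\<Sum>k\<le>n - 1. smult (em (?c k)) (?u (n - 1 - k) ^ (CARD('q) ^ k))) ^ CARD('q)))"
    by (simp only: exp_coeff_theta pCons.IH)
  also have "\<dots> = (\<Sum>k\<le>n. smult (em (carlitz_coeff (pCons c a) k)) (?u (n - k) ^ (CARD('q) ^ k)))"
  proof (cases n)
    case 0
    then show ?thesis
      by (simp add: c0 smult_add_left)
  next
    case (Suc m)
    have "(\<Sum>k\<le>m. smult (em (?c k)) (?u (m - k) ^ (CARD('q) ^ k))) ^ CARD('q) =
        (\<Sum>k\<le>m. smult (em (?c k) ^ CARD('q)) (?u (m - k) ^ (CARD('q) ^ Suc k)))"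
      by (simp add: frob_p_sum smult_power power_mult[symmetric] mult.commute)
    moreover have "(\<Sum>k\<le>n. smult (em (carlitz_coeff (pCons c a) k)) (?u (n - k) ^ (CARD('q) ^ k))) =
        smult (em [:c:]) (?u n) + smult (em theta * em (?c 0)) (?u n)
        + (\<Sum>k\<le>m. smult (em theta * em (?c (Suc k))) (?u (m - k) ^ (CARD('q) ^ Suc k)))
        + (\<Sum>k\<le>m. smult (em (?c k) ^ CARD('q)) (?u (m - k) ^ (CARD('q) ^ Suc k)))"
      unfolding Suc by (subst sum.atMost_Suc_shift)
        (simp del: power_Suc add: c0 cS
          smult_add_left sum.distrib)
    moreover have "smult (em theta) (\<Sum>k\<le>n. smult (em (?c k)) (?u (n - k) ^ (CARD('q) ^ k))) =
        smult (em theta * em (?c 0)) (?u n)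
        + (\<Sum>k\<le>m. smult (em theta * em (?c (Suc k))) (?u (m - k) ^ (CARD('q) ^ Suc k)))"
      unfolding Suc by (subst sum.atMost_Suc_shift) (simp del: power_Suc add: smult_add_right smult_sum_right)
    ultimately show ?thesis
      by (simp add: Suc)
  qed
  finally show ?case .
qed

end

section \<open>Integrality\<close>

context A_algebra
begin

text \<open>
  The localization of \<open>A\<close> at \<open>P\<close>, inside the field.
\<close>

definition local_at :: "'q poly \<Rightarrow> 'c set" where
  "local_at P = {em a / em b | a b. \<not> P dvd b}"

lemma local_at_memI: "\<not> P dvd b \<Longrightarrow> x * em b = em a \<Longrightarrow> x \<in> local_at P"
  unfolding local_at_def by (intro CollectI exI[of _ a] exI[of _ b]) (cases "b = 0"; simp add: eq_divide_eq)

lemma local_at_memE: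
  assumes "x \<in> local_at P"
  obtains a b where "\<not> P dvd b" "x * em b = em a" "em b \<noteq> 0"
proof -
  obtain a b where "\<not> P dvd b" "x = em a / em b"
    using assms unfolding local_at_def by auto
  then show ?thesis
    by (intro that[of b a]) (cases "b = 0"; simp)+
qed

lemma A_subset_local_at: "prime_elem P \<Longrightarrow> em a \<in> local_at P"
  by (rule local_at_memI[of P 1]) (auto simp: prime_elem_def)

lemma subring_local_at:
  assumes P: "prime_elem P"
  shows "is_subring (local_at P)"
proof -
  have "x - y \<in> local_at P \<and> x * y \<in> local_at P" if xy: "x \<in> local_at P" "y \<in> local_at P" for x y
  proof -
    obtain a b where ab: "\<not> P dvd b" "x * em b = em a"
      using xy(1) by (rule local_at_memE)
    obtain c d where cd: "\<not> P dvd d" "y * em d = em c"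
      using xy(2) by (rule local_at_memE)
    have bd: "\<not> P dvd b * d"
      using ab(1) cd(1) prime_elem_dvd_multD[OF P] by blast
    have "(x - y) * em (b * d) = (x * em b) * em d - (y * em d) * em b"
      by (simp add: em_mult algebra_simps)
    then have "(x - y) * em (b * d) = em (a * d - c * b)"
      by (simp only: ab cd em_mult em_diff)
    moreover have "(x * y) * em (b * d) = (x * em b) * (y * em d)"
      by (simp add: em_mult)
    then have "(x * y) * em (b * d) = em (a * c)"
      by (simp only: ab cd em_mult)
    ultimately show ?thesis
      using local_at_memI[OF bd] by blast
  qed
  then show ?thesis
    using A_subset_local_at[OF P, of 1] A_subset_local_at[OF P, of 0]
    by (auto simp: is_subring_def submodule_of_def)
qed

text \<open>
  The maximal ideal of the localization at \<open>P\<close>.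
\<close>

definition max_ideal :: "'q poly \<Rightarrow> 'c set" where
  "max_ideal P = (\<lambda>x. em P * x) ` local_at P"

lemma max_ideal_submodule:
  assumes P: "prime_elem P"
  shows "submodule_of (local_at P) (max_ideal P)"
proof -
  note R = is_subring_self[OF subring_local_at[OF P]]
  show ?thesis
    unfolding submodule_of_def max_ideal_def
  proof (intro conjI ballI)
    show "0 \<in> (*) (em P) ` local_at P"
      using submodule_0[OF R] by (auto intro!: image_eqI[of _ _ 0])
    show "x - y \<in> (*) (em P) ` local_at P" if "x \<in> (*) (em P) ` local_at P" "y \<in> (*) (em P) ` local_at P" for x y
      using that submodule_diff[OF R] by (auto simp flip: right_diff_distrib)
    show "r * x \<in> (*) (em P) ` local_at P" if "r \<in> local_at P" "x \<in> (*) (em P) ` local_at P" for r x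
      using that submodule_mult[OF R] by (auto simp: mult.left_commute[of r])
  qed
qed

lemma em_mem_max_ideal:
  assumes P: "prime_elem P" and "P dvd a"
  shows "em a \<in> max_ideal P"
proof -
  obtain b where "a = P * b"
    using assms(2) ..
  then show ?thesis
    using A_subset_local_at[OF P, of b] by (auto simp: max_ideal_def em_mult)
qed

text \<open>
  The residue field of \<open>P\<close> has \<open>q^(deg P)\<close> elements.
\<close>

lemma frobenius_local_at:
  assumes P: "prime_elem P" and x: "x \<in> local_at P"
  shows "x ^ (CARD('q) ^ degree P) - x \<in> max_ideal P"
proof -
  let ?Q = "CARD('q) ^ degree P"
  obtain a b where ab: "\<not> P dvd b" "x * em b = em a" "em b \<noteq> 0"
    using x by (rule local_at_memE)
  have dvd: "P dvd c ^ ?Q - c" for c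
    using prime_dvd_theta_frob[OF P] theta_frob_dvd[of "degree P" c] by (rule dvd_trans)
  have Q: "?Q = Suc (?Q - 1)"
    using card_gt_1[where 'q = 'q] by (simp add: Suc_diff_1)
  have "P dvd b * (a ^ ?Q - a) - a * (b ^ ?Q - b)"
    by (rule dvd_diff[OF dvd_mult[OF dvd] dvd_mult[OF dvd]])
  then have "P dvd a ^ ?Q * b - a * b ^ ?Q"
    by (simp add: algebra_simps)
  then obtain c where c: "a ^ ?Q * b - a * b ^ ?Q = P * c" ..
  have bQ: "\<not> P dvd b ^ ?Q * b"
    using ab(1) prime_elem_dvd_multD[OF P] prime_elem_dvd_power[OF P] by blast
  have "(x ^ ?Q - x) * em (b ^ ?Q * b) = (x * em b) ^ ?Q * em b - (x * em b) * em b ^ ?Q"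
    by (simp add: em_mult em_power power_mult_distrib algebra_simps)
  also have "\<dots> = em (a ^ ?Q * b - a * b ^ ?Q)"
    by (simp only: ab em_mult em_power em_diff)
  also have "\<dots> = em P * em c"
    by (simp only: c em_mult)
  finally have "x ^ ?Q - x = em P * (em c / em (b ^ ?Q * b))"
    using bQ by (cases "b ^ ?Q * b = 0") (auto simp: field_simps simp del: mult_eq_0_iff power_eq_0_iff)
  moreover have "em c / em (b ^ ?Q * b) \<in> local_at P"
    using bQ unfolding local_at_def by blast
  ultimately show ?thesis
    unfolding max_ideal_def by blast
qed

lemma carlitz_em_over_A: "carlitz_em a \<in> polys_over (range em)"
  by (auto simp: polys_over_def carlitz_em_def coeff_map_poly)

lemma polys_over_local_at: "prime_elem P \<Longrightarrow> f \<in> polys_over (range em) \<Longrightarrow> f \<in> polys_over (local_at P)"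
  using A_subset_local_at polys_over_mono[of "range em" "local_at P"] by blast

lemma carlitz_prime_cong:
  assumes P: "prime_elem P" and lc: "lead_coeff P = 1"
  shows "carlitz_em P - monom 1 (CARD('q) ^ degree P) \<in> polys_over (max_ideal P)"
proof -
  have "carlitz_em P = (\<Sum>k<degree P. monom (em (carlitz_coeff P k)) (CARD('q) ^ k))
      + monom 1 (CARD('q) ^ degree P)"
    unfolding carlitz_em_eq_sum lessThan_Suc_atMost[symmetric]
    by (simp add: carlitz_coeff_degree lc flip: one_pCons)
  moreover have "(\<Sum>k<degree P. monom (em (carlitz_coeff P k)) (CARD('q) ^ k)) \<in> polys_over (max_ideal P)"
  proof (intro polys_over_sum[OF max_ideal_submodule[OF P]])
    fix k assume "k \<in> {..<degree P}"
    then have "em (carlitz_coeff P k) \<in> max_ideal P"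
      using prime_dvd_carlitz_coeff[OF P] em_mem_max_ideal[OF P] by auto
    then show "monom (em (carlitz_coeff P k)) (CARD('q) ^ k) \<in> polys_over (max_ideal P)"
      using submodule_0[OF max_ideal_submodule[OF P]] by (auto simp: polys_over_def)
  qed
  ultimately show ?thesis
    by simp
qed

text \<open>
  Substituting \<open>C\<^sub>P(X)\<close> for \<open>X\<close> lifts the Frobenius: modulo \<open>P\<close> it is the power \<open>q^(deg P)\<close> on the
  coefficients by \<open>frobenius_local_at\<close>, and on \<open>X\<close> by \<open>carlitz_prime_cong\<close>.
\<close>

lemma frobenius_lift:
  assumes P: "prime_elem P" and lc: "lead_coeff P = 1" and "f \<in> polys_over (local_at P)"
  shows "pcompose f (carlitz_em P) - f ^ (CARD('q) ^ degree P) \<in> polys_over (max_ideal P)"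
  using assms(3)
proof (induction f)
  case 0
  then show ?case
    using polys_over_0[OF max_ideal_submodule[OF P]] by (simp add: frob_pow_zero[OF frob_p])
next
  case (pCons c f)
  let ?Q = "CARD('q) ^ degree P" and ?C = "carlitz_em P"
  note I = max_ideal_submodule[OF P] and R = subring_local_at[OF P]
  have c: "c \<in> local_at P" and f: "f \<in> polys_over (local_at P)"
    using polys_over_pConsD[OF pCons.prems] by auto
  have X: "monom 1 ?Q = [:0, 1::'c:] ^ ?Q"
    by (simp add: monom_altdef)
  have "pCons c f = [:c:] + [:0, 1:] * f"
    by simp
  then have "pCons c f ^ ?Q = [:c ^ ?Q:] + monom 1 ?Q * f ^ ?Q"
    by (simp only: frob_pow_add[OF frob_p] power_mult_distrib X poly_const_pow)
  then have "pcompose (pCons c f) ?C - pCons c f ^ ?Q = [:c:] + ?C * pcompose f ?C - ([:c ^ ?Q:] + monom 1 ?Q * f ^ ?Q)"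
    by (simp only: pcompose_pCons)
  also have "\<dots> = ([:c:] - [:c ^ ?Q:]) + (?C * (pcompose f ?C - f ^ ?Q) + f ^ ?Q * (?C - monom 1 ?Q))"
    by (simp only: algebra_simps)
  also have "[:c:] - [:c ^ ?Q:] = 0 - [:c ^ ?Q - c:]"
    by simp
  also have "\<dots> + (?C * (pcompose f ?C - f ^ ?Q) + f ^ ?Q * (?C - monom 1 ?Q)) \<in> polys_over (max_ideal P)"
    by (rule polys_over_add[OF I polys_over_diff[OF I polys_over_0[OF I] polys_over_const[OF I frobenius_local_at[OF P c]]]
      polys_over_add[OF I polys_over_mult[OF I polys_over_local_at[OF P carlitz_em_over_A] pCons.IH[OF f]]
        polys_over_mult[OF I polys_over_power[OF R f] carlitz_prime_cong[OF P lc]]]])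
  finally show ?case .
qed

lemma exp_coeff_prime_multiple:
  assumes P: "prime_elem P" and g: "\<And>d. g d \<in> polys_over (local_at P)"
  shows "exp_coeff (\<lambda>d. smult (em P) (g d)) n \<in> polys_over (max_ideal P)"
  unfolding exp_coeff_def smult_power smult_smult
proof (intro polys_over_sum[OF max_ideal_submodule[OF P]] polys_over_smult_ideal[OF max_ideal_submodule[OF P]])
  fix i
  show "g (n - i) ^ (CARD('q) ^ i) \<in> polys_over (local_at P)"
    by (intro polys_over_power subring_local_at P g)
  obtain k b where kb: "carlitz_D i = P ^ k * b" "\<not> P dvd b" "k < CARD('q) ^ i"
    using carlitz_D_prime_part[OF P] by blast
  \<comment> \<open>One factor \<open>P\<close> is kept apart to land in the maximal ideal.\<close>
  define m where "m = CARD('q) ^ i - k - 1"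
  have m: "CARD('q) ^ i = k + Suc m"
    using kb(3) by (simp add: m_def)
  have "P \<noteq> 0"
    using P by auto
  then have "inverse (em (carlitz_D i)) * em P ^ (CARD('q) ^ i) = em P * (em (P ^ m) / em b)"
    using kb(2) by (auto simp: kb(1) m em_mult em_power power_add field_simps)
  moreover have "em (P ^ m) / em b \<in> local_at P"
    using kb(2) unfolding local_at_def by blast
  ultimately show "inverse (em (carlitz_D i)) * em P ^ (CARD('q) ^ i) \<in> max_ideal P"
    unfolding max_ideal_def by blast
qed

text \<open>
  The terms with \<open>P | a\<close> are those with \<open>a = P b\<close>, and there \<open>F(C\<^sub>a(X))\<close> arises from \<open>F(C\<^sub>b(X))\<close> by
  substituting \<open>C\<^sub>P(X)\<close> for \<open>X\<close>.
\<close>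

lemma twisted_sum_split:
  assumes P: "prime_elem P" and lc: "lead_coeff P = 1"
  shows "smult (em P) (twisted_sum F d) =
    smult (em P) (\<Sum>a\<in>{a \<in> A_plus d. \<not> P dvd a}. smult (inverse (em a)) (pcompose F (carlitz_em a)))
    + (if d < degree P then 0 else pcompose (twisted_sum F (d - degree P)) (carlitz_em P))"
proof -
  let ?t = "\<lambda>a. smult (inverse (em a)) (pcompose F (carlitz_em a))"
  have P0: "P \<noteq> 0"
    using lc by auto
  have "twisted_sum F d = sum ?t {a \<in> A_plus d. \<not> P dvd a} + sum ?t {a \<in> A_plus d. P dvd a}"
    unfolding twisted_sum_def
    by (subst sum.union_disjoint[symmetric]) (auto intro!: sum.cong intro: finite_subset[OF _ finite_A_plus])
  moreover have "smult (em P) (sum ?t {a \<in> A_plus d. P dvd a}) =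
      (if d < degree P then 0 else pcompose (twisted_sum F (d - degree P)) (carlitz_em P))"
  proof (cases "d < degree P")
    case False
    have "sum ?t {a \<in> A_plus d. P dvd a} = (\<Sum>b\<in>A_plus (d - degree P). ?t (P * b))"
      using False P0 by (simp add: A_plus_prime_multiples[OF lc] sum.reindex inj_on_def)
    moreover have "smult (em P) (?t (P * b)) = pcompose (?t b) (carlitz_em P)" for b
    proof -
      have "pcompose F (carlitz_em (P * b)) = pcompose (pcompose F (carlitz_em b)) (carlitz_em P)"
        by (simp only: mult.commute[of P] carlitz_em_mult pcompose_assoc)
      then show ?thesis
        using P0 by (simp add: em_mult pcompose_smult field_simps)
    qed
    ultimately show ?thesis
      using False by (simp add: smult_sum_right twisted_sum_def pcompose_sum)
  qed (simp add: A_plus_prime_multiples[OF lc])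
  ultimately show ?thesis
    by (simp add: smult_add_right)
qed

lemma exp_coeff_shift:
  "exp_coeff (\<lambda>d. if d < e then 0 else pcompose (h (d - e)) Q) n =
    (if n < e then 0 else pcompose (exp_coeff h (n - e)) Q)"
proof -
  have "exp_coeff (\<lambda>d. if d < e then 0 else pcompose (h (d - e)) Q) n =
      (\<Sum>i\<in>{i\<in>{..n}. e \<le> n - i}. smult (inverse (em (carlitz_D i))) (pcompose (h (n - i - e)) Q ^ (CARD('q) ^ i)))"
    unfolding exp_coeff_def
    by (rule sum.mono_neutral_cong_right) (auto simp: frob_pow_zero[OF frob_p])
  also have "\<dots> = (if n < e then 0 else pcompose (exp_coeff h (n - e)) Q)"
  proof (cases "n < e")
    case False
    then have "{i\<in>{..n}. e \<le> n - i} = {..n - e}"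
      by auto
    moreover have "n - i - e = n - e - i" for i
      by simp
    ultimately show ?thesis
      using False by (simp add: exp_coeff_def pcompose_sum pcompose_smult pcompose_power)
  next
    case True
    then have "{i\<in>{..n}. e \<le> n - i} = {}"
      by auto
    then show ?thesis
      using True by (simp only: sum.empty if_True)
  qed
  finally show ?thesis .
qed

text \<open>
  By \<open>twisted_sum_split\<close> and \<open>exp_coeff_carlitz\<close>, the sequence \<open>u\<close> of the \<open>T\<^sub>n(F)\<close> satisfies
  \<open>C\<^sub>P(u) = exp\<^sub>C(P g) + \<sigma>(u)\<close> with \<open>g\<close> integral at \<open>P\<close>. The coefficient of \<open>Z^(q^n)\<close> on the left is \<open>P u\<^sub>n\<close> plus
  terms in earlier members of the sequence. Modulo \<open>P\<close> only \<open>u\<^sub>m^(q^e)\<close> with \<open>m = n - e\<close> and \<open>e = deg P\<close>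
  survives among those, and it cancels against \<open>\<sigma>(u)\<close> by \<open>frobenius_lift\<close>. So \<open>P u\<^sub>n\<close> lies in the
  maximal ideal.
\<close>

lemma L_term_local_at:
  assumes P: "prime_elem P" and lc: "lead_coeff P = 1" and F: "F \<in> polys_over (range em)"
  shows "L_term F n \<in> polys_over (local_at P)"
proof (induction n rule: less_induct)
  case (less n)
  note I = max_ideal_submodule[OF P] and R = subring_local_at[OF P]
  let ?u = "L_term F" and ?e = "degree P"
  define g where "g d = (\<Sum>a\<in>{a \<in> A_plus d. \<not> P dvd a}. smult (inverse (em a)) (pcompose F (carlitz_em a)))" for d
  have g: "g d \<in> polys_over (local_at P)" for d
    unfolding g_def
  proof (intro polys_over_sum[OF is_subring_self[OF R]] polys_over_smult[OF is_subring_self[OF R]])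
    fix a assume "a \<in> {a \<in> A_plus d. \<not> P dvd a}"
    then show "inverse (em a) \<in> local_at P"
      by (cases "a = 0") (auto intro!: local_at_memI[of P a _ 1])
    show "pcompose F (carlitz_em a) \<in> polys_over (local_at P)"
      by (intro polys_over_pcompose[OF is_subring_self[OF R]] polys_over_local_at[OF P] F carlitz_em_over_A)
  qed
  have e: "0 < ?e"
    using P by (rule prime_degree_pos)
  define w where "w = exp_coeff (\<lambda>d. smult (em P) (g d)) n"
  define \<sigma>u where "\<sigma>u = (if n < ?e then 0 else pcompose (?u (n - ?e)) (carlitz_em P))"
  have "exp_coeff (\<lambda>d. smult (em P) (twisted_sum F d)) n = w + \<sigma>u"
    unfolding twisted_sum_split[OF P lc] g_def[symmetric] exp_coeff_add
    by (simp add: w_def \<sigma>u_def exp_coeff_shift L_term_def)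
  then have eq: "(\<Sum>k\<le>n. smult (em (carlitz_coeff P k)) (?u (n - k) ^ (CARD('q) ^ k))) = w + \<sigma>u"
    unfolding exp_coeff_carlitz by (simp add: L_term_def)
  \<comment> \<open>The term \<open>\<sigma>u\<close> is moved to the index \<open>deg P\<close>, where it cancels modulo \<open>P\<close>.\<close>
  define t where "t k = smult (em (carlitz_coeff P k)) (?u (n - k) ^ (CARD('q) ^ k))
    - (if k = ?e then pcompose (?u (n - ?e)) (carlitz_em P) else 0)" for k
  have "(\<Sum>k\<le>n. smult (em (carlitz_coeff P k)) (?u (n - k) ^ (CARD('q) ^ k))) =
      smult (em P) (?u n) + (\<Sum>k\<in>{1..n}. smult (em (carlitz_coeff P k)) (?u (n - k) ^ (CARD('q) ^ k)))"
    by (simp add: atMost_atLeast0 sum.atLeast_Suc_atMost[of 0 n] carlitz_coeff_at_0)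
  also have "(\<Sum>k\<in>{1..n}. smult (em (carlitz_coeff P k)) (?u (n - k) ^ (CARD('q) ^ k))) = sum t {1..n} + \<sigma>u"
    using e by (auto simp: t_def sum_subtractf \<sigma>u_def)
  finally have "smult (em P) (?u n) = w - sum t {1..n}"
    using eq by (simp add: algebra_simps)
  moreover have "w \<in> polys_over (max_ideal P)"
    unfolding w_def by (rule exp_coeff_prime_multiple[OF P g])
  moreover have "sum t {1..n} \<in> polys_over (max_ideal P)"
  proof (rule polys_over_sum[OF I])
    fix k assume k: "k \<in> {1..n}"
    then have u: "?u (n - k) \<in> polys_over (local_at P)"
      by (intro less.IH) auto
    consider "k < ?e" | "k = ?e" | "k > ?e"
      by linarith
    then show "t k \<in> polys_over (max_ideal P)"
    proof cases
      case 1
      then have "em (carlitz_coeff P k) \<in> max_ideal P"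
        by (intro em_mem_max_ideal[OF P] prime_dvd_carlitz_coeff[OF P])
      then show ?thesis
        using 1 u by (auto simp: t_def intro!: polys_over_smult_ideal[OF I] polys_over_power[OF R])
    next
      case 2
      then have "t k = 0 - (pcompose (?u (n - k)) (carlitz_em P) - ?u (n - k) ^ (CARD('q) ^ ?e))"
        by (simp add: t_def carlitz_coeff_degree lc flip: one_pCons)
      then show ?thesis
        using polys_over_diff[OF I polys_over_0[OF I] frobenius_lift[OF P lc u]] by simp
    next
      case 3
      then show ?thesis
        using polys_over_0[OF I] by (simp add: t_def carlitz_coeff_eq_0)
    qed
  qed
  ultimately have "smult (em P) (?u n) \<in> polys_over (max_ideal P)"
    using polys_over_diff[OF I] by simp
  moreover have "em P \<noteq> 0"
    using P by auto
  ultimately show ?case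
    by (auto simp: polys_over_def max_ideal_def)
qed

text \<open>
  A prime dividing the denominator of a fraction that is integral at this prime can be cancelled.
\<close>

lemma in_A_if_local_everywhere:
  assumes x: "\<And>P. prime_elem P \<Longrightarrow> lead_coeff P = 1 \<Longrightarrow> x \<in> local_at P"
    and "b \<noteq> 0" "x * em b = em a"
  shows "x \<in> range em"
  using assms(2,3)
proof (induction "degree b" arbitrary: a b rule: less_induct)
  case less
  show ?case
  proof (cases "degree b = 0")
    case True
    then obtain c where c: "b = [:c:]"
      by (rule degree_eq_zeroE)
    then have "[:inverse c:] * b = 1"
      using less.prems(1) by (simp add: one_pCons)
    then have 1: "em b * em [:inverse c:] = 1"
      by (simp only: em_mult[symmetric] mult.commute[of b] em_1)
    have "x = x * em b * em [:inverse c:]"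
      by (simp only: mult.assoc 1 mult_1_right)
    also have "\<dots> = em (a * [:inverse c:])"
      by (simp only: less.prems(2) em_mult)
    finally show ?thesis
      by blast
  next
    case False
    then obtain P where P: "prime_elem P" "lead_coeff P = 1" "P dvd b"
      using monic_prime_divisor[of b] by auto
    obtain c d where cd: "\<not> P dvd d" "x * em d = em c"
      using x[OF P(1,2)] by (rule local_at_memE)
    have "em (a * d) = em (b * c)"
      by (simp only: em_mult cd(2)[symmetric] less.prems(2)[symmetric]) (simp only: ac_simps)
    then have "a * d = b * c"
      by simp
    then have "P dvd a"
      using P(1,3) cd(1) by (metis dvd_mult2 prime_elem_dvd_multD)
    then obtain a' where a': "a = P * a'" ..
    obtain b' where b': "b = P * b'"
      using P(3) ..
    have P0: "P \<noteq> 0" "0 < degree P"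
      using P(1) prime_degree_pos by auto
    show ?thesis
    proof (rule less.hyps)
      show "b' \<noteq> 0"
        using b' less.prems(1) by auto
      then show "degree b' < degree b"
        using P0 by (simp add: b' degree_mult_eq)
      show "x * em b' = em a'"
        using less.prems(2) P0 by (simp add: a' b' em_mult)
    qed
  qed
qed

theorem L_term_integral:
  assumes F: "F \<in> polys_over (range em)"
  shows "L_term F n \<in> polys_over (range em)"
proof -
  have "coeff (L_term F n) m \<in> range em" for m
  proof -
    obtain P :: "'q poly" where P: "prime_elem P" "lead_coeff P = 1"
      using monic_prime_divisor[of "[:0, 1:]"] by auto
    have loc: "coeff (L_term F n) m \<in> local_at P" if "prime_elem P" "lead_coeff P = 1" for P
      using L_term_local_at[OF that F] by (simp add: polys_over_def)
    obtain a b where "coeff (L_term F n) m * em b = em a" "em b \<noteq> 0"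
      using loc[OF P] by (rule local_at_memE)
    then show ?thesis
      using loc by (intro in_A_if_local_everywhere[of _ b a]) auto
  qed
  then show ?thesis
    by (simp add: polys_over_def)
qed

end

section \<open>Torsion points and vanishing\<close>

lemma degree_prod_linear: "finite S \<Longrightarrow> degree (\<Prod>x\<in>S. [:-x, 1:]) = card S"
  for S :: "'a::field set"
  by (subst degree_prod_eq_sum_degree) auto

lemma lead_coeff_prod_linear: "lead_coeff (\<Prod>x\<in>S. [:-x, 1:]) = 1"
  for S :: "'a::field set"
  by (induction S rule: infinite_finite_induct) (simp_all add: lead_coeff_mult del: mult_pCons_left)

text \<open>
  The top coefficient in the Lagrange interpolation formula, when the derivative of the node polynomial
  \<open>f\<close> takes the same value \<open>c\<close> at all nodes.
\<close>

lemma lagrange_top_coeff: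
  fixes p :: "'a::field poly"
  assumes S: "finite S" and c: "c \<noteq> 0"
    and f: "degree f = card S" "lead_coeff f = 1" "\<And>x. x \<in> S \<Longrightarrow> poly f x = 0"
    and df: "\<And>x. x \<in> S \<Longrightarrow> poly (pderiv f) x = c"
    and p: "degree p < card S"
  shows "(\<Sum>x\<in>S. poly p x) = c * coeff p (card S - 1)"
proof -
  define g where "g x = (\<Prod>y\<in>S - {x}. [:-y, 1:])" for x
  have dg: "degree (g x) = card S - 1" if "x \<in> S" for x
    using that S by (simp add: g_def degree_prod_linear)
  have lg: "lead_coeff (g x) = 1" for x
    unfolding g_def by (rule lead_coeff_prod_linear)
  have "f = (\<Prod>x\<in>S. [:-x, 1:])"
  proof (rule poly_eqI_degree_lead_coeff[where A = S and n = "card S"])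
    show "coeff f (card S) = coeff (\<Prod>x\<in>S. [:-x, 1:]) (card S)"
      using f(1,2) lead_coeff_prod_linear[of S] degree_prod_linear[OF S] by simp
    show "poly f z = poly (\<Prod>x\<in>S. [:-x, 1:]) z" if "z \<in> S" for z
      using that S f(3)[OF that] by (auto simp: poly_prod)
  qed (use f(1) degree_prod_linear[OF S] in auto)
  then have fg: "f = [:-x, 1:] * g x" if "x \<in> S" for x
    using that S by (simp add: g_def prod.remove[of S x])
  have gx: "poly (g x) x = c" if "x \<in> S" for x
  proof -
    have "pderiv f = [:-x, 1:] * pderiv (g x) + g x"
      by (subst fg[OF that]) (simp only: pderiv_mult, simp add: pderiv_pCons)
    then show ?thesis
      using df[OF that] by simp
  qed
  have gy: "poly (g x) y = 0" if "y \<in> S" "y \<noteq> x" for x y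
    using that S by (auto simp: g_def poly_prod)
  have "p = (\<Sum>x\<in>S. smult (poly p x / c) (g x))"
  proof (rule poly_eqI_degree[where A = S])
    fix y assume y: "y \<in> S"
    have "poly (\<Sum>x\<in>S. smult (poly p x / c) (g x)) y = (\<Sum>x\<in>S. if x = y then poly p y else 0)"
      unfolding poly_sum using gx gy y c by (intro sum.cong) auto
    then show "poly p y = poly (\<Sum>x\<in>S. smult (poly p x / c) (g x)) y"
      using y S by simp
  next
    have "degree (\<Sum>x\<in>S. smult (poly p x / c) (g x)) \<le> card S - 1"
      using S dg by (intro degree_sum_le) (auto intro: order_trans[OF degree_smult_le])
    then show "degree (\<Sum>x\<in>S. smult (poly p x / c) (g x)) < card S"
      using p by linarith
  qed (rule p)
  then have "coeff p (card S - 1) = coeff (\<Sum>x\<in>S. smult (poly p x / c) (g x)) (card S - 1)"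
    by simp
  also have "\<dots> = (\<Sum>x\<in>S. poly p x / c)"
    using dg lg by (auto simp: coeff_sum intro!: sum.cong) (metis mult_1_right)
  also have "\<dots> = (\<Sum>x\<in>S. poly p x) / c"
    by (simp add: sum_divide_distrib)
  finally show ?thesis
    using c by simp
qed

context A_algebra
begin

lemma coeff_carlitz_em: "coeff (carlitz_em a) (CARD('q) ^ k) = em (carlitz_coeff a k)"
  by (simp add: carlitz_em_def coeff_map_poly carlitz_coeff_def)

lemma degree_carlitz_em: "a \<noteq> 0 \<Longrightarrow> degree (carlitz_em a) = CARD('q) ^ degree a"
proof (rule antisym)
  assume "a \<noteq> 0"
  then show "CARD('q) ^ degree a \<le> degree (carlitz_em a)"
    by (intro le_degree) (simp add: coeff_carlitz_em carlitz_coeff_degree)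
  show "degree (carlitz_em a) \<le> CARD('q) ^ degree a"
    unfolding carlitz_em_eq_sum using card_gt_1[where 'q = 'q]
    by (intro degree_sum_le) (auto intro!: order_trans[OF degree_monom_le] power_increasing)
qed

lemma lead_coeff_carlitz_em: "lead_coeff a = 1 \<Longrightarrow> lead_coeff (carlitz_em a) = 1"
  by (cases "a = 0")
    (simp_all add: degree_carlitz_em coeff_carlitz_em carlitz_coeff_degree flip: one_pCons)

lemma pderiv_carlitz_em: "pderiv (carlitz_em a) = [:em a:]"
proof -
  have "of_nat CARD('q) = (0::'c)"
    using char_power_em card_gt_1[where 'q = 'q] by (auto simp: char_power_def dest: spec[of _ 1])
  then have "pderiv (monom x (CARD('q) ^ k)) = (if k = 0 then [:x:] else 0)" for x :: 'c and k
    by (simp add: pderiv_monom zero_power monom_0)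
  moreover have "pderiv (\<Sum>x\<in>S. f x) = (\<Sum>x\<in>S. pderiv (f x))" for f :: "nat \<Rightarrow> 'c poly" and S
    by (induction S rule: infinite_finite_induct) (simp_all add: pderiv_add)
  ultimately show ?thesis
    by (simp add: carlitz_em_eq_sum carlitz_coeff_at_0)
qed

lemma carlitz_em_1: "carlitz_em 1 = [:0, 1:]"
  by (simp add: carlitz_em_def carlitz_1 map_poly_pCons)

lemma poly_carlitz_em_theta: "poly (carlitz_em theta) x = em theta * x + x ^ CARD('q)"
proof -
  have "carlitz_coeff theta (Suc 0) = (1 :: 'q poly)"
    using carlitz_coeff_degree[of "theta :: 'q poly"] by (simp add: one_pCons)
  then show ?thesis
    by (simp add: carlitz_em_eq_sum carlitz_coeff_at_0 poly_monom)
qed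

text \<open>
  Torsion by powers of \<open>\<theta>\<close> is enough: these points are infinitely many, and all \<open>C\<^sub>a\<close> act on them.
\<close>

definition torsion :: "'c set" where
  "torsion = {x. \<exists>D. poly (carlitz_em (theta ^ D)) x = 0}"

lemma poly_carlitz_em_0: "poly (carlitz_em a) 0 = 0"
  by (simp add: carlitz_em_eq_sum poly_sum poly_monom zero_power)

lemma torsion_carlitz: "x \<in> torsion \<Longrightarrow> poly (carlitz_em a) x \<in> torsion"
proof -
  assume "x \<in> torsion"
  then obtain D where D: "poly (carlitz_em (theta ^ D)) x = 0"
    by (auto simp: torsion_def)
  have "poly (carlitz_em (theta ^ D)) (poly (carlitz_em a) x) = poly (carlitz_em a) (poly (carlitz_em (theta ^ D)) x)"
    by (simp only: poly_pcompose[symmetric] carlitz_em_commute[of a])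
  then show ?thesis
    unfolding torsion_def D poly_carlitz_em_0 by blast
qed

end

text \<open>
  The absolute value extends that of \<open>A\<close> at infinity, and all \<open>\<theta>^D\<close>-torsion points of the Carlitz module
  lie in the field.
\<close>

locale carlitz_field = A_algebra em for em :: "'q::{field,finite} poly \<Rightarrow> 'c::field" +
  fixes v :: "'c \<Rightarrow> real"
  assumes v_nonneg: "v x \<ge> 0"
    and v_eq_0_iff: "v x = 0 \<longleftrightarrow> x = 0"
    and v_mult: "v (x * y) = v x * v y"
    and v_add: "v (x + y) \<le> max (v x) (v y)"
    and v_em: "a \<noteq> 0 \<Longrightarrow> v (em a) = real CARD('q) ^ degree a"
    and card_torsion: "card {x. poly (carlitz_em (theta ^ D)) x = 0} = CARD('q) ^ D"
begin

lemma v_0 [simp]: "v 0 = 0"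
  by (simp add: v_eq_0_iff)

lemma v_1 [simp]: "v 1 = 1"
  using v_em[of 1] by simp

lemma v_power: "v (x ^ n) = v x ^ n"
  by (induction n) (simp_all add: v_mult)

lemma v_inverse: "v (inverse x) = inverse (v x)"
proof (cases "x = 0")
  case False
  then have "v (inverse x) * v x = 1"
    by (simp flip: v_mult)
  then show ?thesis
    using False by (simp add: field_simps v_eq_0_iff)
qed simp

lemma v_minus: "v (- x) = v x"
proof -
  have "v (-1) * v (-1) = 1"
    by (simp flip: v_mult)
  then have "v (-1) = 1"
    using v_nonneg[of "-1"] by (metis abs_of_nonneg abs_square_eq_1 power2_eq_square)
  then show ?thesis
    using v_mult[of "-1" x] by simp
qed

lemma v_sum_less:
  assumes "\<And>x. x \<in> S \<Longrightarrow> v (f x) < B" "0 < B"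
  shows "v (sum f S) < B"
  using assms
proof (induction S rule: infinite_finite_induct)
  case (insert x S)
  then show ?case
    using v_add[of "f x" "sum f S"] by (auto simp: less_max_iff_disj intro: le_less_trans)
qed auto

lemma v_sum_le:
  assumes "\<And>x. x \<in> S \<Longrightarrow> v (f x) \<le> B" "0 \<le> B"
  shows "v (sum f S) \<le> B"
  using assms
proof (induction S rule: infinite_finite_induct)
  case (insert x S)
  then show ?case
    using v_add[of "f x" "sum f S"] by (auto intro: order_trans)
qed auto

lemma v_add_eq:
  assumes "v x < v y"
  shows "v (x + y) = v y"
proof -
  have "v y \<le> max (v (x + y)) (v x)"
    using v_add[of "x + y" "- x"] by (simp add: v_minus)
  then show ?thesis
    using v_add[of x y] assms by (auto simp: max_def split: if_splits)
qed

text \<open>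
  Outside the disc \<open>|x|^(q-1) \<le> q\<close> the term \<open>x^q\<close> dominates in \<open>C\<^sub>\<theta>(x)\<close>, and iterating \<open>C\<^sub>\<theta>\<close> leads ever further
  away from 0.
\<close>

lemma not_torsion_if_large:
  assumes "v x ^ (CARD('q) - 1) > real CARD('q)"
  shows "poly (carlitz_em (theta ^ D)) x \<noteq> 0"
  using assms
proof (induction D arbitrary: x)
  case 0
  then have "x \<noteq> 0"
    using card_gt_1[where 'q = 'q] by (auto simp: zero_power)
  then show ?case
    by (simp add: carlitz_em_1)
next
  case (Suc D)
  let ?q = "CARD('q)" and ?y = "poly (carlitz_em theta) x"
  have q: "?q = Suc (?q - 1)" and q1: "1 < real ?q"
    using card_gt_1[where 'q = 'q] by simp_all
  have x1: "1 < v x"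
  proof (rule ccontr)
    assume "\<not> 1 < v x"
    then have "v x ^ (?q - 1) \<le> 1"
      using v_nonneg by (intro power_le_one) auto
    then show False
      using Suc.prems q1 by linarith
  qed
  have vq: "v (x ^ ?q) = v x * v x ^ (?q - 1)"
    by (subst q) (simp only: power_Suc v_mult v_power)
  have "v (em theta * x) < v (x ^ ?q)"
    using Suc.prems x1 unfolding vq by (simp add: v_mult v_em mult.commute[of _ "v x"])
  then have y: "v ?y = v x * v x ^ (?q - 1)"
    unfolding poly_carlitz_em_theta using v_add_eq vq by simp
  moreover have "1 \<le> v x ^ (?q - 1)"
    using x1 by (intro one_le_power) auto
  ultimately have "v x \<le> v ?y"
    using x1 by (simp add: mult_le_cancel_left1)
  then have "v x ^ (?q - 1) \<le> v ?y ^ (?q - 1)"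
    using v_nonneg by (intro power_mono)
  then have "poly (carlitz_em (theta ^ D)) ?y \<noteq> 0"
    using Suc.prems by (intro Suc.IH) linarith
  then show ?case
    unfolding power_Suc2 carlitz_em_mult poly_pcompose .
qed

lemma torsion_power_bound:
  assumes "x \<in> torsion" "k < CARD('q)"
  shows "v x ^ k \<le> real CARD('q)"
proof -
  have b: "v x ^ (CARD('q) - 1) \<le> real CARD('q)"
  proof (rule ccontr)
    assume "\<not> v x ^ (CARD('q) - 1) \<le> real CARD('q)"
    then have "poly (carlitz_em (theta ^ D)) x \<noteq> 0" for D
      by (intro not_torsion_if_large) (simp only: not_le)
    then show False
      using assms(1) by (simp add: torsion_def)
  qed
  show ?thesis
  proof (cases "v x \<le> 1")
    case True
    then have "v x ^ k \<le> 1"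
      using v_nonneg by (intro power_le_one) auto
    also have "1 \<le> real CARD('q)"
      using card_gt_1[where 'q = 'q] by simp
    finally show ?thesis .
  next
    case False
    then have "v x ^ k \<le> v x ^ (CARD('q) - 1)"
      using assms(2) by (intro power_increasing) auto
    then show ?thesis
      using b by linarith
  qed
qed

text \<open>
  The product of the \<open>l\<close>-th powers of \<open>C\<^sub>b(X)\<close>, where \<open>b\<close> runs over the \<open>\<theta>^i\<close> with \<open>i < D\<close> and \<open>l\<close> is the \<open>i\<close>-th
  digit of \<open>k\<close> in base \<open>q\<close>. Each of the \<open>D\<close> factors is at most \<open>q\<close> at torsion points, whereas \<open>X^k\<close> would
  only satisfy a bound exponential in \<open>k\<close>.
\<close>

lemma small_monic_poly:
  assumes "k < CARD('q) ^ D"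
  shows "\<exists>G. degree G = k \<and> lead_coeff G = 1 \<and> (\<forall>x\<in>torsion. v (poly G x) \<le> real CARD('q) ^ D)"
  using assms
proof (induction D arbitrary: k)
  case 0
  then show ?case
    by (intro exI[of _ 1]) auto
next
  case (Suc D)
  let ?q = "CARD('q)" and ?C = "carlitz_em (theta ^ D)"
  define l m where "l = k div ?q ^ D" and "m = k mod ?q ^ D"
  have k: "k = l * ?q ^ D + m"
    by (simp only: l_def m_def div_mult_mod_eq)
  have "m < ?q ^ D"
    using card_gt_1[where 'q = 'q] by (simp add: m_def)
  then obtain G where G: "degree G = m" "lead_coeff G = 1" "\<forall>x\<in>torsion. v (poly G x) \<le> real ?q ^ D"
    using Suc.IH by blast
  have l: "l < ?q"
    using Suc.prems by (simp add: l_def less_mult_imp_div_less)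
  have deg: "degree (theta ^ D :: 'q poly) = D" and lc: "lead_coeff (theta ^ D :: 'q poly) = 1"
    by (rule theta_power)+
  have C: "degree ?C = ?q ^ D" "lead_coeff ?C = 1"
    using deg lead_coeff_carlitz_em[OF lc] by (simp_all add: degree_carlitz_em)
  have 0: "?C \<noteq> 0" "G \<noteq> 0"
    using C(2) G(2) by auto
  show ?case
  proof (intro exI[of _ "?C ^ l * G"] conjI ballI)
    show "degree (?C ^ l * G) = k"
      using 0 C G by (simp add: degree_mult_eq degree_power_eq k)
    show "lead_coeff (?C ^ l * G) = 1"
      unfolding lead_coeff_mult lead_coeff_power C(2) G(2) by simp
    fix x assume x: "x \<in> torsion"
    have "v (poly (?C ^ l * G) x) = v (poly ?C x) ^ l * v (poly G x)"
      by (simp add: v_mult v_power)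
    also have "\<dots> \<le> real ?q * real ?q ^ D"
      using torsion_power_bound[OF torsion_carlitz[OF x] l] G(3) x v_nonneg
      by (intro mult_mono) auto
    finally show "v (poly (?C ^ l * G) x) \<le> real ?q ^ Suc D"
      by simp
  qed
qed

text \<open>
  Multiplication by a polynomial \<open>G\<close> from \<open>small_monic_poly\<close> raises the degree of \<open>p\<close> to \<open>q^D - 1\<close> without changing the
  leading coefficient. By \<open>lagrange_top_coeff\<close> at the \<open>q^D\<close> roots of \<open>C\<^sub>b\<close> for \<open>b = \<theta>^D\<close>, that coefficient is the
  sum of the values of \<open>p G\<close> divided by \<open>\<theta>^D\<close>. The factor \<open>q^D\<close> that bounds \<open>G\<close> cancels against \<open>|\<theta>^D|\<close>, so it
  is less than 1, and elements of \<open>A\<close> that small are 0.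
\<close>

lemma poly_over_A_eq_0_if_small:
  assumes p: "p \<in> polys_over (range em)" and small: "\<And>x. x \<in> torsion \<Longrightarrow> v (poly p x) < 1"
  shows "p = 0"
proof (rule ccontr)
  assume p0: "p \<noteq> 0"
  let ?q = "CARD('q)"
  define D where "D = degree p"
  define N where "N = ?q ^ D"
  have N: "degree p < N"
    unfolding N_def D_def by (rule less_card_power)
  obtain G where G: "degree G = N - 1 - degree p" "lead_coeff G = 1"
      "\<forall>x\<in>torsion. v (poly G x) \<le> real ?q ^ D"
    using small_monic_poly[of "N - 1 - degree p" D] N unfolding N_def by auto
  define f where "f = carlitz_em (theta ^ D)"
  define S where "S = {x. poly f x = 0}"
  have deg: "degree (theta ^ D :: 'q poly) = D" and lc: "lead_coeff (theta ^ D :: 'q poly) = 1"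
    by (rule theta_power)+
  have cS: "card S = N"
    unfolding S_def f_def N_def by (rule card_torsion)
  have fS: "finite S"
    using cS N card.infinite by fastforce
  have S: "S \<subseteq> torsion"
    by (auto simp: S_def f_def torsion_def)
  have G0: "G \<noteq> 0"
    using G(2) by auto
  have dpG: "degree (p * G) = N - 1"
    using p0 G0 G(1) N by (simp add: degree_mult_eq)
  have "(\<Sum>x\<in>S. poly (p * G) x) = em (theta ^ D) * coeff (p * G) (card S - 1)"
  proof (rule lagrange_top_coeff[OF fS])
    show "degree f = card S" "lead_coeff f = 1"
      using deg lead_coeff_carlitz_em[OF lc] by (simp_all add: f_def cS N_def degree_carlitz_em)
  qed (use N dpG cS in \<open>auto simp: S_def f_def pderiv_carlitz_em\<close>)
  also have "coeff (p * G) (card S - 1) = lead_coeff p"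
    using lead_coeff_mult[of p G] G(2) dpG cS by simp
  finally have eq: "(\<Sum>x\<in>S. poly (p * G) x) = em (theta ^ D) * lead_coeff p" .
  obtain a where a: "lead_coeff p = em a"
    using p by (auto simp: polys_over_def)
  have "a \<noteq> 0"
    using a p0 by auto
  then have "1 \<le> v (lead_coeff p)"
    using card_gt_1[where 'q = 'q] by (simp add: a v_em)
  then have "real ?q ^ D * 1 \<le> real ?q ^ D * v (lead_coeff p)"
    by (intro mult_left_mono) auto
  also have "\<dots> = v (\<Sum>x\<in>S. poly (p * G) x)"
    unfolding eq v_mult by (simp add: v_em deg)
  also have "\<dots> < real ?q ^ D"
  proof (rule v_sum_less)
    fix x assume "x \<in> S"
    then have x: "x \<in> torsion"
      using S by auto
    have "v (poly (p * G) x) \<le> v (poly p x) * real ?q ^ D"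
      using G(3) x v_nonneg by (auto simp: v_mult intro: mult_left_mono)
    also have "\<dots> < 1 * real ?q ^ D"
      using small[OF x] card_gt_1[where 'q = 'q] by (intro mult_strict_right_mono) auto
    finally show "v (poly (p * G) x) < real ?q ^ D"
      by simp
  qed (use card_gt_1[where 'q = 'q] in auto)
  finally show False
    by simp
qed

lemma v_twisted_sum:
  assumes F: "\<And>x. x \<in> torsion \<Longrightarrow> v (poly F x) \<le> c" and x: "x \<in> torsion"
  shows "v (poly (twisted_sum F d) x) \<le> c / real CARD('q) ^ d"
  unfolding twisted_sum_def poly_sum
proof (rule v_sum_le)
  fix a :: "'q poly" assume "a \<in> A_plus d"
  then have "a \<noteq> 0" "degree a = d"
    by (auto simp: A_plus_def)
  then have "v (poly (smult (inverse (em a)) (pcompose F (carlitz_em a))) x) =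
      v (poly F (poly (carlitz_em a) x)) / real CARD('q) ^ d"
    by (simp add: v_mult v_inverse v_em poly_pcompose divide_inverse mult.commute)
  also have "\<dots> \<le> c / real CARD('q) ^ d"
    by (intro divide_right_mono F torsion_carlitz x) auto
  finally show "v (poly (smult (inverse (em a)) (pcompose F (carlitz_em a))) x) \<le> c / real CARD('q) ^ d" .
next
  have "0 \<le> c"
    using F[OF x] v_nonneg order_trans by blast
  then show "0 \<le> c / real CARD('q) ^ d"
    by simp
qed

text \<open>
  At torsion points the \<open>i\<close>-th summand of \<open>T\<^sub>n(F)\<close> is at most \<open>(c / q^(n-i))^(q^i) / q^(i q^i) = (c / q^n)^(q^i) < 1\<close>,
  while \<open>T\<^sub>n(F)\<close> has coefficients in \<open>A\<close>.
\<close>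

theorem L_term_eq_0:
  assumes F: "F \<in> polys_over (range em)"
    and c: "\<And>x. x \<in> torsion \<Longrightarrow> v (poly F x) \<le> c" "c < real CARD('q) ^ n"
  shows "L_term F n = 0"
proof (rule poly_over_A_eq_0_if_small)
  show "L_term F n \<in> polys_over (range em)"
    by (rule L_term_integral[OF F])
  fix x assume x: "x \<in> torsion"
  let ?q = "real CARD('q)"
  have q: "1 < ?q"
    using card_gt_1[where 'q = 'q] by simp
  show "v (poly (L_term F n) x) < 1"
    unfolding L_term_def exp_coeff_def poly_sum
  proof (rule v_sum_less)
    fix i assume "i \<in> {..n}"
    then have i: "i \<le> n" by simp
    let ?Q = "CARD('q) ^ i"
    have c0: "0 \<le> c"
      using c(1)[OF x] v_nonneg order_trans by blast
    have "v (poly (smult (inverse (em (carlitz_D i))) (twisted_sum F (n - i) ^ ?Q)) x) =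
        v (poly (twisted_sum F (n - i)) x) ^ ?Q / (?q ^ i) ^ ?Q"
      using carlitz_D_nonzero[of i, where 'q = 'q]
      by (simp add: v_mult v_inverse v_em v_power degree_carlitz_D power_mult divide_inverse mult.commute)
    also have "\<dots> \<le> (c / ?q ^ (n - i)) ^ ?Q / (?q ^ i) ^ ?Q"
      using v_nonneg by (intro divide_right_mono power_mono v_twisted_sum c(1) x) auto
    also have "\<dots> = (c / ?q ^ n) ^ ?Q"
      using i by (simp add: power_divide[symmetric] power_add[symmetric])
    also have "\<dots> \<le> c / ?q ^ n"
      using power_decreasing[of 1 ?Q "c / ?q ^ n"] c(2) c0 q by (simp add: Suc_le_eq)
    also have "\<dots> < 1"
      using c(2) q by (simp add: field_simps)
    finally show "v (poly (smult (inverse (em (carlitz_D i))) (twisted_sum F (n - i) ^ ?Q)) x) < 1" .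
  qed simp
qed

lemma bounded_on_torsion: "\<exists>c. \<forall>x\<in>torsion. v (poly F x) \<le> c"
proof (induction F)
  case (pCons a F)
  then obtain c where c: "\<forall>x\<in>torsion. v (poly F x) \<le> c"
    by blast
  show ?case
  proof (intro exI ballI)
    fix x assume x: "x \<in> torsion"
    have "v (x * poly F x) \<le> real CARD('q) * c"
      unfolding v_mult using torsion_power_bound[OF x, of 1] card_gt_1[where 'q = 'q] c x v_nonneg
      by (intro mult_mono) auto
    then show "v (poly (pCons a F) x) \<le> max (v a) (real CARD('q) * c)"
      using v_add[of a "x * poly F x"] by auto
  qed
qed auto

lemma L_term_eventually_0:
  assumes F: "F \<in> polys_over (range em)"
  shows "\<forall>\<^sub>F n in sequentially. L_term F n = 0"
proof -
  obtain c where c: "\<forall>x\<in>torsion. v (poly F x) \<le> c"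
    using bounded_on_torsion by blast
  have "1 < real CARD('q)"
    using card_gt_1[where 'q = 'q] by simp
  then obtain m where m: "c < real CARD('q) ^ m"
    using real_arch_pow by blast
  show ?thesis
    using eventually_ge_at_top[of m]
  proof eventually_elim
    case (elim n)
    have "real CARD('q) ^ m \<le> real CARD('q) ^ n"
      using elim card_gt_1[where 'q = 'q] by (intro power_increasing) auto
    then show ?case
      using c m by (intro L_term_eq_0[OF F, of c]) auto
  qed
qed

end

section \<open>Polynomials in one variable with vanishing terms\<close>

lemma sum_const_poly: "(\<Sum>x\<in>S. [:f x:]) = [:\<Sum>x\<in>S. f x:]"
  by (induction S rule: infinite_finite_induct) simp_all

context A_algebra
begin

lemma twisted_sum_add: "twisted_sum (F + G) d = twisted_sum F d + twisted_sum G d"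
  by (simp add: twisted_sum_def pcompose_add smult_add_right sum.distrib)

lemma L_term_add: "L_term (F + G) n = L_term F n + L_term G n"
proof -
  have "twisted_sum (F + G) = (\<lambda>d. twisted_sum F d + twisted_sum G d)"
    by (rule ext) (rule twisted_sum_add)
  then show ?thesis
    by (simp add: L_term_def exp_coeff_add)
qed

definition inverse_sum :: "nat \<Rightarrow> 'c" where
  "inverse_sum d = (\<Sum>a\<in>A_plus d. inverse (em a))"

lemma twisted_sum_const: "twisted_sum [:x:] d = [:inverse_sum d * x:]"
  by (simp add: twisted_sum_def inverse_sum_def sum_const_poly sum_distrib_right)

text \<open>
  The polynomial \<open>E\<^sub>n\<close> with \<open>T\<^sub>n(x) = E\<^sub>n(x)\<close> for constants \<open>x\<close>.
\<close>

definition const_term_poly :: "nat \<Rightarrow> 'c poly" where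
  "const_term_poly n =
    (\<Sum>i\<le>n. monom (inverse (em (carlitz_D i)) * inverse_sum (n - i) ^ (CARD('q) ^ i)) (CARD('q) ^ i))"

lemma L_term_const: "L_term [:x:] n = [:poly (const_term_poly n) x:]"
  by (simp add: L_term_def exp_coeff_def twisted_sum_const poly_const_pow sum_const_poly
      const_term_poly_def poly_sum poly_monom power_mult_distrib mult.assoc)

lemma const_term_poly_degree: "const_term_poly n \<noteq> 0" "degree (const_term_poly n) \<le> CARD('q) ^ n"
proof -
  have "(A_plus 0 :: 'q poly set) = {1}"
    by (auto simp: A_plus_def one_pCons elim!: degree_eq_zeroE)
  then have "inverse_sum 0 = 1"
    by (simp add: inverse_sum_def)
  moreover have "CARD('q) ^ i = CARD('q) ^ n \<longleftrightarrow> i = n" for i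
    using card_gt_1[where 'q = 'q] by (simp add: power_inject_exp)
  ultimately have "coeff (const_term_poly n) (CARD('q) ^ n) = inverse (em (carlitz_D n))"
    by (simp add: const_term_poly_def coeff_sum)
  then show "const_term_poly n \<noteq> 0"
    using carlitz_D_nonzero[of n, where 'q = 'q] by auto
  show "degree (const_term_poly n) \<le> CARD('q) ^ n"
    unfolding const_term_poly_def using card_gt_1[where 'q = 'q]
    by (intro degree_sum_le) (auto intro!: order_trans[OF degree_monom_le] power_increasing)
qed

lemma coeff_twisted_sum_top:
  assumes "degree F \<le> M"
  shows "coeff (twisted_sum F d) (M * CARD('q) ^ d) = coeff (twisted_sum [:coeff F M:] d) 0"
  unfolding twisted_sum_def coeff_sum
proof (rule sum.cong[OF refl])
  fix a :: "'q poly" assume "a \<in> A_plus d"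
  then have a: "a \<noteq> 0" "degree a = d" "lead_coeff a = 1"
    by (auto simp: A_plus_def)
  have dC: "degree (carlitz_em a) = CARD('q) ^ d" "lead_coeff (carlitz_em a) = 1"
    using a(1,2) degree_carlitz_em lead_coeff_carlitz_em[OF a(3)] by simp_all
  have q: "0 < CARD('q) ^ d"
    using card_gt_1[where 'q = 'q] by simp
  have dp: "degree (pcompose F (carlitz_em a)) = degree F * CARD('q) ^ d"
    by (simp add: degree_pcompose dC)
  have "coeff (pcompose F (carlitz_em a)) (M * CARD('q) ^ d) = coeff F M"
  proof (cases "degree F = M")
    case True
    then show ?thesis
      using lead_coeff_comp[of "carlitz_em a" F] dC q dp by simp
  next
    case False
    then have "degree F * CARD('q) ^ d < M * CARD('q) ^ d"
      using assms q by (intro mult_strict_right_mono) auto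
    then show ?thesis
      using False assms by (simp add: coeff_eq_0 dp)
  qed
  then show "coeff (smult (inverse (em a)) (pcompose F (carlitz_em a))) (M * CARD('q) ^ d) =
      coeff (smult (inverse (em a)) (pcompose [:coeff F M:] (carlitz_em a))) 0"
    by simp
qed

text \<open>
  For monic \<open>a\<close> of degree \<open>d\<close> the polynomial \<open>C\<^sub>a\<close> is monic of degree \<open>q^d\<close>, so in top degree \<open>F\<close> can be replaced by
  its leading term; powers of \<open>q\<close> act on the coefficients.
\<close>

lemma coeff_L_term_top:
  assumes "degree F \<le> M"
  shows "coeff (L_term F n) (M * CARD('q) ^ n) = poly (const_term_poly n) (coeff F M)"
proof -
  have "coeff (L_term F n) (M * CARD('q) ^ n) = coeff (L_term [:coeff F M:] n) 0"
    unfolding L_term_def exp_coeff_def coeff_sum coeff_smult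
  proof (intro sum.cong refl arg_cong2[where f = times])
    fix i assume "i \<in> {..n}"
    then have "M * CARD('q) ^ n = (M * CARD('q) ^ (n - i)) * CARD('q) ^ i"
      by (simp add: mult.assoc flip: power_add)
    then have "coeff (twisted_sum F (n - i) ^ (CARD('q) ^ i)) (M * CARD('q) ^ n) =
        coeff (twisted_sum F (n - i)) (M * CARD('q) ^ (n - i)) ^ (CARD('q) ^ i)"
      by (simp only: coeff_frob_pow(1)[OF char_power_em])
    also have "\<dots> = coeff (twisted_sum [:coeff F M:] (n - i) ^ (CARD('q) ^ i)) (0 * CARD('q) ^ i)"
      by (simp only: coeff_twisted_sum_top[OF assms] coeff_frob_pow(1)[OF char_power_em])
    finally show "coeff (twisted_sum F (n - i) ^ (CARD('q) ^ i)) (M * CARD('q) ^ n) =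
        coeff (twisted_sum [:coeff F M:] (n - i) ^ (CARD('q) ^ i)) 0"
      by simp
  qed
  then show ?thesis
    by (simp add: L_term_const)
qed

end

context carlitz_field
begin

text \<open>
  A constant \<open>em a\<close> with \<open>deg a < n\<close> is bounded by \<open>|a| < q^n\<close>, so \<open>L_term_eq_0\<close> makes it a root of \<open>E\<^sub>n\<close>. This
  already gives as many roots as the degree allows.
\<close>

lemma in_A_if_const_term_0:
  assumes n: "0 < n" and x: "poly (const_term_poly n) x = 0"
  shows "x \<in> range em"
proof -
  let ?Z = "{x. poly (const_term_poly n) x = 0}"
  have fin: "finite ?Z"
    by (rule poly_roots_finite[OF const_term_poly_degree(1)])
  have "em ` polys_lt n \<subseteq> ?Z"
  proof (intro image_subsetI CollectI)
    fix a :: "'q poly" assume a: "a \<in> polys_lt n"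
    have "L_term [:em a:] n = 0"
    proof (rule L_term_eq_0)
      show "[:em a:] \<in> polys_over (range em)"
        by (rule polys_over_const[OF is_subring_self[OF subring_A]]) simp
      show "v (poly [:em a:] x) \<le> v (em a)" for x
        by simp
      show "v (em a) < real CARD('q) ^ n"
      proof (cases "a = 0")
        case False
        then show ?thesis
          using a n card_gt_1[where 'q = 'q] by (simp add: v_em mem_polys_lt_iff)
      qed (use card_gt_1[where 'q = 'q] in simp)
    qed
    then show "poly (const_term_poly n) (em a) = 0"
      by (simp add: L_term_const)
  qed
  moreover have "card ?Z \<le> card (em ` polys_lt n)"
  proof -
    have "card (em ` polys_lt n) = CARD('q) ^ n"
      using card_polys_lt[where 'a = 'q, of n] by (subst card_image) (auto simp: inj_on_def)
    then show ?thesis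
      using card_poly_roots_bound[OF const_term_poly_degree(1)[of n]] const_term_poly_degree(2)[of n]
      by linarith
  qed
  ultimately have "em ` polys_lt n = ?Z"
    using fin by (intro card_seteq)
  then show ?thesis
    using x by blast
qed

text \<open>
  The leading coefficient lies in \<open>A\<close> by \<open>in_A_if_const_term_0\<close>; the leading term can then be subtracted,
  since its own terms \<open>T\<^sub>n\<close> vanish for large \<open>n\<close>.
\<close>

theorem over_A_if_L_term_eventually_0:
  assumes "\<forall>\<^sub>F n in sequentially. L_term F n = 0"
  shows "F \<in> polys_over (range em)"
  using assms
proof (induction "degree F" arbitrary: F rule: less_induct)
  case less
  let ?M = "degree F" and ?c = "lead_coeff F"
  note A = is_subring_self[OF subring_A]
  have "\<forall>\<^sub>F n in sequentially. L_term F n = 0 \<and> 0 < n"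
    using less.prems eventually_gt_at_top[of 0] by eventually_elim simp
  then obtain n where n: "L_term F n = 0" "0 < n"
    by (auto simp: eventually_sequentially)
  have c: "?c \<in> range em"
    using coeff_L_term_top[of F ?M n] n by (intro in_A_if_const_term_0[of n]) simp_all
  then have G: "monom ?c ?M \<in> polys_over (range em)"
    by (auto simp: polys_over_def intro: submodule_0[OF A])
  define H where "H = F - monom ?c ?M"
  have F: "F = H + monom ?c ?M"
    by (simp add: H_def)
  have "H \<in> polys_over (range em)"
  proof (cases "?M = 0")
    case True
    then have "F = monom ?c ?M"
      by (auto simp: monom_0 elim!: degree_eq_zeroE)
    then show ?thesis
      by (simp add: H_def polys_over_0[OF A])
  next
    case False
    show ?thesis
    proof (rule less.hyps)
      have "degree H \<le> ?M"
        unfolding H_def by (intro degree_diff_le) (auto simp: degree_monom_le)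
      moreover have "coeff H ?M = 0"
        by (simp add: H_def)
      ultimately show "degree H < ?M"
        using False by (metis degree_0 leading_coeff_0_iff le_neq_implies_less neq0_conv)
      show "\<forall>\<^sub>F n in sequentially. L_term H n = 0"
        using less.prems L_term_eventually_0[OF G]
      proof eventually_elim
        case (elim n)
        then show ?case
          using L_term_add[of H "monom ?c ?M" n] by (simp flip: F)
      qed
    qed
  qed
  then show ?case
    using G by (subst F) (rule polys_over_add[OF A])
qed

end

section \<open>Evaluation of polynomials in several variables\<close>

definition mono_eval :: "(nat \<Rightarrow> 'a::comm_ring_1 poly) \<Rightarrow> (nat \<Rightarrow>\<^sub>0 nat) \<Rightarrow> 'a poly" where
  "mono_eval g m = (\<Prod>i\<in>Poly_Mapping.keys m. g i ^ Poly_Mapping.lookup m i)"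

text \<open>
  The ring homomorphism with \<open>X\<^sub>i \<mapsto> g i\<close>.
\<close>

definition mpol_eval :: "(nat \<Rightarrow> 'a::comm_ring_1 poly) \<Rightarrow> 'a mpol \<Rightarrow> 'a poly" where
  "mpol_eval g F = (\<Sum>m\<in>Poly_Mapping.keys F. smult (Poly_Mapping.lookup F m) (mono_eval g m))"

lemma mono_eval_superset:
  "finite S \<Longrightarrow> Poly_Mapping.keys m \<subseteq> S \<Longrightarrow> mono_eval g m = (\<Prod>i\<in>S. g i ^ Poly_Mapping.lookup m i)"
  unfolding mono_eval_def by (rule prod.mono_neutral_left) (auto simp: in_keys_iff)

lemma mono_eval_add: "mono_eval g (m + n) = mono_eval g m * mono_eval g n"
proof -
  let ?S = "Poly_Mapping.keys m \<union> Poly_Mapping.keys n"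
  have "Poly_Mapping.keys (m + n) \<subseteq> ?S"
    by (rule keys_add)
  then show ?thesis
    by (simp add: mono_eval_superset[of ?S] lookup_add power_add prod.distrib)
qed

lemma mono_eval_0: "mono_eval g 0 = 1"
  by (simp add: mono_eval_def)

lemma mpol_eval_superset:
  "finite S \<Longrightarrow> Poly_Mapping.keys F \<subseteq> S \<Longrightarrow>
    mpol_eval g F = (\<Sum>m\<in>S. smult (Poly_Mapping.lookup F m) (mono_eval g m))"
  unfolding mpol_eval_def by (rule sum.mono_neutral_left) (auto simp: in_keys_iff)

lemma mpol_eval_0 [simp]: "mpol_eval g 0 = 0"
  by (simp add: mpol_eval_def)

lemma mpol_eval_add: "mpol_eval g (F + G) = mpol_eval g F + mpol_eval g G"
proof -
  let ?S = "Poly_Mapping.keys F \<union> Poly_Mapping.keys G"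
  have "Poly_Mapping.keys (F + G) \<subseteq> ?S"
    by (rule keys_add)
  then show ?thesis
    by (simp add: mpol_eval_superset[of ?S] lookup_add smult_add_left sum.distrib)
qed

lemma mpol_eval_sum: "mpol_eval g (\<Sum>x\<in>S. f x) = (\<Sum>x\<in>S. mpol_eval g (f x))"
  by (induction S rule: infinite_finite_induct) (simp_all add: mpol_eval_add)

lemma mpol_eval_single: "mpol_eval g (Poly_Mapping.single m c) = smult c (mono_eval g m)"
  by (simp add: mpol_eval_def)

lemma mpol_as_sum: "F = (\<Sum>m\<in>Poly_Mapping.keys F. Poly_Mapping.single m (Poly_Mapping.lookup F m))"
  by (rule poly_mapping_eqI) (auto simp: lookup_sum lookup_single when_def in_keys_iff)

lemma mpol_eval_mult: "mpol_eval g (F * G) = mpol_eval g F * mpol_eval g G"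
proof -
  have "F * G = (\<Sum>m\<in>Poly_Mapping.keys F. \<Sum>n\<in>Poly_Mapping.keys G.
      Poly_Mapping.single (m + n) (Poly_Mapping.lookup F m * Poly_Mapping.lookup G n))"
    by (subst mpol_as_sum[of F], subst mpol_as_sum[of G]) (simp add: sum_product mult_single)
  then show ?thesis
    by (simp add: mpol_eval_sum mpol_eval_single mono_eval_add mpol_eval_def[of g F]
        mpol_eval_def[of g G] sum_product mult.commute)
qed

lemma mpol_eval_1: "mpol_eval g 1 = 1"
  using mpol_eval_single[of g 0 1] by (simp add: mono_eval_0)

lemma mpol_eval_power: "mpol_eval g (F ^ n) = mpol_eval g F ^ n"
  by (induction n) (simp_all add: mpol_eval_1 mpol_eval_mult)

lemma mpol_eval_prod: "mpol_eval g (\<Prod>x\<in>S. f x) = (\<Prod>x\<in>S. mpol_eval g (f x))"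
  by (induction S rule: infinite_finite_induct) (simp_all add: mpol_eval_1 mpol_eval_mult)

lemma mpol_eval_mconst: "mpol_eval g (mconst c) = [:c:]"
  by (simp add: mconst_def mpol_eval_single mono_eval_0)

lemma mpol_eval_mvar: "mpol_eval g (mvar i) = g i"
  by (simp add: mvar_def mpol_eval_single mono_eval_def)

lemma mpol_eval_msubst: "mpol_eval g (msubst F h) = mpol_eval (\<lambda>i. mpol_eval g (h i)) F"
  by (simp add: msubst_def mpol_eval_sum mpol_eval_mult mpol_eval_mconst mpol_eval_prod mpol_eval_power
      mpol_eval_def[of "\<lambda>i. mpol_eval g (h i)"] mono_eval_def)

lemma pcompose_mpol_eval: "pcompose (mpol_eval g F) r = mpol_eval (\<lambda>i. pcompose (g i) r) F"
  by (simp add: mpol_eval_def mono_eval_def pcompose_sum pcompose_smult pcompose_prod pcompose_power)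

section \<open>Kronecker substitution\<close>

lemma sum_digits_less:
  assumes "\<And>i. i < n \<Longrightarrow> d i < B"
  shows "(\<Sum>i<n. d i * B ^ i) < (B::nat) ^ n"
  using assms
proof (induction n)
  case (Suc n)
  then have "(\<Sum>i<n. d i * B ^ i) < B ^ n" and "Suc (d n) * B ^ n \<le> B * B ^ n"
    by (auto intro: mult_le_mono1 simp: Suc_leI simp del: mult_Suc)
  then show ?case
    by simp
qed simp

lemma digits_unique:
  fixes B :: nat
  assumes "\<And>i. i < n \<Longrightarrow> d i < B" "\<And>i. i < n \<Longrightarrow> e i < B"
    and "(\<Sum>i<n. d i * B ^ i) = (\<Sum>i<n. e i * B ^ i)"
  shows "\<forall>i<n. d i = e i"
  using assms
proof (induction n)
  case (Suc n)
  have r: "(\<Sum>i<n. d i * B ^ i) < B ^ n" "(\<Sum>i<n. e i * B ^ i) < B ^ n"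
    using Suc.prems by (auto intro!: sum_digits_less)
  have div: "(a + c * N) div N = c" if "a < N" for a c N :: nat
    using that by (cases "N = 0") simp_all
  have "d n = ((\<Sum>i<n. d i * B ^ i) + d n * B ^ n) div B ^ n"
    by (rule div[OF r(1), symmetric])
  also have "(\<Sum>i<n. d i * B ^ i) + d n * B ^ n = (\<Sum>i<n. e i * B ^ i) + e n * B ^ n"
    using Suc.prems(3) by simp
  also have "\<dots> div B ^ n = e n"
    by (rule div[OF r(2)])
  finally have "d n = e n" .
  then have "\<forall>i<n. d i = e i"
    using Suc.prems by (intro Suc.IH) auto
  then show ?case
    using \<open>d n = e n\<close> by (simp add: less_Suc_eq)
qed simp

text \<open>
  The polynomial \<open>\<phi> m\<close> of largest degree shows its coefficient as the leading coefficient of the sum; then it can be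
  removed.
\<close>

lemma triangular_coeffs:
  fixes c :: "'m \<Rightarrow> 'a::comm_ring_1" and \<phi> :: "'m \<Rightarrow> 'a poly"
  assumes I: "submodule_of R I" and M: "finite M"
    and \<phi>: "\<And>m. m \<in> M \<Longrightarrow> lead_coeff (\<phi> m) = 1" "\<And>m. m \<in> M \<Longrightarrow> \<phi> m \<in> polys_over R"
    and inj: "inj_on (\<lambda>m. degree (\<phi> m)) M"
    and sum: "(\<Sum>m\<in>M. smult (c m) (\<phi> m)) \<in> polys_over I"
  shows "\<forall>m\<in>M. c m \<in> I"
  using M \<phi> inj sum
proof (induction "card M" arbitrary: M)
  case (Suc n)
  have M: "finite M" "M \<noteq> {}"
    using Suc by auto
  have "Max ((\<lambda>m. degree (\<phi> m)) ` M) \<in> (\<lambda>m. degree (\<phi> m)) ` M"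
    using M by (intro Max_in) auto
  then obtain m where m: "m \<in> M" and "degree (\<phi> m) = Max ((\<lambda>m. degree (\<phi> m)) ` M)"
    by auto
  then have max: "degree (\<phi> k) \<le> degree (\<phi> m)" if "k \<in> M" for k
    using M that by simp
  have split: "(\<Sum>k\<in>M. smult (c k) (\<phi> k)) = smult (c m) (\<phi> m) + (\<Sum>k\<in>M - {m}. smult (c k) (\<phi> k))"
    using m M by (simp add: sum.remove)
  have "coeff (smult (c k) (\<phi> k)) (degree (\<phi> m)) = 0" if "k \<in> M - {m}" for k
  proof -
    have "degree (\<phi> k) \<noteq> degree (\<phi> m)"
      using that m Suc.prems(4) by (auto simp: inj_on_def)
    then show ?thesis
      using max[of k] that by (simp add: coeff_eq_0)
  qed
  then have "coeff (\<Sum>k\<in>M. smult (c k) (\<phi> k)) (degree (\<phi> m)) = c m"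
    unfolding split using Suc.prems(2)[OF m] by (simp add: coeff_sum)
  moreover have "coeff (\<Sum>k\<in>M. smult (c k) (\<phi> k)) (degree (\<phi> m)) \<in> I"
    using Suc.prems(5) unfolding polys_over_def mem_Collect_eq by (rule spec)
  ultimately have cm: "c m \<in> I"
    by simp
  have "(\<Sum>k\<in>M - {m}. smult (c k) (\<phi> k)) = (\<Sum>k\<in>M. smult (c k) (\<phi> k)) - smult (c m) (\<phi> m)"
    unfolding split by simp
  also have "\<dots> \<in> polys_over I"
    using Suc.prems(5) Suc.prems(3)[OF m] cm by (intro polys_over_diff[OF I] polys_over_smult_ideal[OF I])
  finally have "\<forall>k\<in>M - {m}. c k \<in> I"
    using Suc.hyps(2) Suc.prems m by (intro Suc.hyps(1)) (auto simp: inj_on_def)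
  then show ?case
    using cm by blast
qed simp

context A_algebra
begin

text \<open>
  The variable \<open>X\<^sub>i\<close> is replaced by \<open>C\<^sub>b(X)\<close> with \<open>b = \<theta>^(k i)\<close>, rather than by a power of \<open>X\<close>, so that the
  substitution commutes with \<open>X \<mapsto> C\<^sub>a(X)\<close>.
\<close>

definition kronecker :: "nat \<Rightarrow> 'c mpol \<Rightarrow> 'c poly" where
  "kronecker k = mpol_eval (\<lambda>i. carlitz_em (theta ^ (k * i)))"

lemma kronecker_degree:
  shows "degree (mono_eval (\<lambda>i. carlitz_em (theta ^ (k * i))) m) =
      (\<Sum>i\<in>Poly_Mapping.keys m. Poly_Mapping.lookup m i * (CARD('q) ^ k) ^ i)"
    and "lead_coeff (mono_eval (\<lambda>i. carlitz_em (theta ^ (k * i))) m) = 1"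
proof -
  have l: "lead_coeff (carlitz_em (theta ^ n)) = 1" for n
    by (intro lead_coeff_carlitz_em theta_power)
  then have n0: "carlitz_em (theta ^ n) \<noteq> 0" for n
    by (metis leading_coeff_0_iff zero_neq_one)
  have d: "degree (carlitz_em (theta ^ n)) = CARD('q) ^ n" for n
    by (simp add: degree_carlitz_em theta_power)
  show "degree (mono_eval (\<lambda>i. carlitz_em (theta ^ (k * i))) m) =
      (\<Sum>i\<in>Poly_Mapping.keys m. Poly_Mapping.lookup m i * (CARD('q) ^ k) ^ i)"
    unfolding mono_eval_def
    by (subst degree_prod_eq_sum_degree) (simp_all add: n0 degree_power_eq d power_mult[symmetric])
  show "lead_coeff (mono_eval (\<lambda>i. carlitz_em (theta ^ (k * i))) m) = 1"
    unfolding mono_eval_def lead_coeff_prod lead_coeff_power l by simp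
qed

lemma mono_eval_over_A:
  "mono_eval (\<lambda>i. carlitz_em (theta ^ (k * i))) m \<in> polys_over (range em)"
proof -
  note A = is_subring_self[OF subring_A]
  have prod: "(\<Prod>i\<in>S. f i) \<in> polys_over (range em)" if "\<And>i. f i \<in> polys_over (range em)" for S and f :: "nat \<Rightarrow> 'c poly"
    using that polys_over_const[OF A is_subring_1[OF subring_A]]
    by (induction S rule: infinite_finite_induct) (auto simp: one_pCons intro: polys_over_mult[OF A])
  show ?thesis
    unfolding mono_eval_def by (intro prod polys_over_power subring_A carlitz_em_over_A)
qed

text \<open>
  For \<open>q^k\<close> larger than all exponents in \<open>F\<close>, the degree \<open>\<Sum> m\<^sub>i q^(k i)\<close> of the image of a monomial \<open>m\<close> has the
  exponents \<open>m\<^sub>i\<close> as its digits in base \<open>q^k\<close>. The case \<open>I = 0\<close> is injectivity, the case \<open>I = A\<close> is integrality.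
\<close>

lemma kronecker_reflects:
  assumes F: "F \<in> mpols s UNIV"
  shows "\<exists>k. \<forall>I. submodule_of (range em) I \<longrightarrow> kronecker k F \<in> polys_over I \<longrightarrow>
    (\<forall>m\<in>Poly_Mapping.keys F. Poly_Mapping.lookup F m \<in> I)"
proof -
  define E where "E = (\<Union>m\<in>Poly_Mapping.keys F. Poly_Mapping.lookup m ` Poly_Mapping.keys m)"
  have "finite E"
    by (auto simp: E_def)
  \<comment> \<open>Inserting 0 provides for an \<open>F\<close> without variables, where \<open>E\<close> is empty.\<close>
  define k where "k = Suc (Max (insert 0 E))"
  let ?B = "CARD('q) ^ k"
  have B: "Poly_Mapping.lookup m i < ?B" if "m \<in> Poly_Mapping.keys F" for m i
  proof (cases "i \<in> Poly_Mapping.keys m")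
    case True
    then have "Poly_Mapping.lookup m i \<in> insert 0 E"
      using that by (auto simp: E_def)
    then have "Poly_Mapping.lookup m i \<le> Max (insert 0 E)"
      using \<open>finite E\<close> by (intro Max_ge) auto
    also have "\<dots> < k"
      by (simp add: k_def)
    also have "\<dots> < ?B"
      by (rule less_card_power)
    finally show ?thesis .
  next
    case False
    then show ?thesis
      using card_gt_1[where 'q = 'q] by (simp add: in_keys_iff)
  qed
  have sub: "Poly_Mapping.keys m \<subseteq> {..<Suc s}" if "m \<in> Poly_Mapping.keys F" for m
  proof -
    have "Poly_Mapping.keys m \<subseteq> {1..s}"
      using F that by (simp add: mpols_def)
    also have "\<dots> \<subseteq> {..<Suc s}"
      by auto
    finally show ?thesis .
  qed
  let ?g = "\<lambda>i. carlitz_em (theta ^ (k * i))"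
  have deg: "degree (mono_eval ?g m) = (\<Sum>i<Suc s. Poly_Mapping.lookup m i * ?B ^ i)"
    if "m \<in> Poly_Mapping.keys F" for m
    unfolding kronecker_degree using sub[OF that]
    by (intro sum.mono_neutral_left) (simp_all add: in_keys_iff)
  have inj: "inj_on (\<lambda>m. degree (mono_eval ?g m)) (Poly_Mapping.keys F)"
  proof (rule inj_onI, rule poly_mapping_eqI)
    fix m m' i assume m: "m \<in> Poly_Mapping.keys F" "m' \<in> Poly_Mapping.keys F"
      and "degree (mono_eval ?g m) = degree (mono_eval ?g m')"
    then have *: "\<forall>i<Suc s. Poly_Mapping.lookup m i = Poly_Mapping.lookup m' i"
      using B by (intro digits_unique[of _ _ ?B]) (simp_all only: deg)
    show "Poly_Mapping.lookup m i = Poly_Mapping.lookup m' i"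
    proof (cases "i < Suc s")
      case False
      then have "i \<notin> Poly_Mapping.keys m" "i \<notin> Poly_Mapping.keys m'"
        using sub[OF m(1)] sub[OF m(2)] by auto
      then show ?thesis
        by (simp add: in_keys_iff)
    qed (use * in blast)
  qed
  show ?thesis
  proof (intro exI[of _ k] allI impI)
    fix I assume I: "submodule_of (range em) I" and "kronecker k F \<in> polys_over I"
    then show "\<forall>m\<in>Poly_Mapping.keys F. Poly_Mapping.lookup F m \<in> I"
      unfolding kronecker_def mpol_eval_def using inj
      by (intro triangular_coeffs[OF I, where \<phi> = "mono_eval ?g"] kronecker_degree(2) mono_eval_over_A) auto
  qed
qed

end

section \<open>The coefficients of \<open>L(F, Z)\<close>\<close>

text \<open>
  The coefficient of \<open>Z^(q^n)\<close> in \<open>L(F, Z)\<close>, as \<open>L_series_nth\<close> shows.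
\<close>

definition L_mpol_term :: "('q::{field,finite} fls alg_closure \<Rightarrow> 'c::field) \<Rightarrow> 'c mpol \<Rightarrow> nat \<Rightarrow> 'c mpol" where
  "L_mpol_term j F n =
    (\<Sum>i\<le>n. mconst (inverse (A_emb j (carlitz_D i))) * L_coeff j F (n - i) ^ (CARD('q) ^ i))"

lemma power_CARD_dvd_iff:
  "CARD('q::{field,finite}) ^ i dvd CARD('q) ^ n \<longleftrightarrow> i \<le> n"
proof
  assume "CARD('q) ^ i dvd CARD('q) ^ n"
  then show "i \<le> n"
    by (rule power_dvd_imp_le[OF _ card_gt_1])
qed (rule le_imp_power_dvd)

lemma L_arg_nth:
  fixes j :: "'q::{field,finite} fls alg_closure \<Rightarrow> 'c::field"
  shows "fps_nth (L_arg j F) (CARD('q) ^ n) = L_coeff j F n"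
    and "(\<And>n. m \<noteq> CARD('q) ^ n) \<Longrightarrow> fps_nth (L_arg j F) m = 0"
proof -
  let ?f = "\<lambda>d. fps_const (L_coeff j F d) * fps_X ^ (CARD('q) ^ d)"
  have f: "fps_nth (?f d) m = (if m = CARD('q) ^ d then L_coeff j F d else 0)" for d m
    by (simp only: fps_mult_left_const_nth fps_X_power_nth) simp
  have "?f sums Abs_fps (\<lambda>n. \<Sum>i\<le>n. fps_nth (?f i) n)"
  proof (rule sums_fpsI)
    fix i n :: nat assume "n < i"
    then show "fps_nth (?f i) n = 0"
      using less_card_power[of i, where 'q = 'q] unfolding f by auto
  qed
  then have eq: "L_arg j F = Abs_fps (\<lambda>n. \<Sum>i\<le>n. fps_nth (?f i) n)"
    using L_arg_sums sums_unique2 by blast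
  have inj: "CARD('q) ^ n = CARD('q) ^ i \<longleftrightarrow> i = n" for i
    using card_gt_1[where 'q = 'q] by (auto simp: power_inject_exp)
  have "n \<le> CARD('q) ^ n"
    using less_card_power[of n, where 'q = 'q] by simp
  then show "fps_nth (L_arg j F) (CARD('q) ^ n) = L_coeff j F n"
    unfolding eq fps_nth_Abs_fps f inj by simp
  show "fps_nth (L_arg j F) m = 0" if "\<And>n. m \<noteq> CARD('q) ^ n"
    unfolding eq fps_nth_Abs_fps f using that by simp
qed

lemma L_series_nth:
  fixes j :: "'q::{field,finite} fls alg_closure \<Rightarrow> 'c::field"
  assumes c: "char_power TYPE('c) CARD('q)"
  shows "fps_nth (L_series j F) (CARD('q) ^ n) = L_mpol_term j F n"
    and "(\<And>n. m \<noteq> CARD('q) ^ n) \<Longrightarrow> fps_nth (L_series j F) m = 0"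
proof -
  let ?G = "L_arg j F" and ?D = "\<lambda>i. mconst (inverse (A_emb j (carlitz_D i)))"
  let ?f = "\<lambda>i. fps_const (?D i) * ?G ^ (CARD('q) ^ i)"
  have c': "char_power TYPE('c mpol) CARD('q)"
    by (rule char_power_poly_mapping[OF c])
  have q0: "0 < CARD('q) ^ i" for i
    using card_gt_1[where 'q = 'q] by simp
  have f: "fps_nth (?f i) m = (if CARD('q) ^ i dvd m
      then ?D i * fps_nth ?G (m div CARD('q) ^ i) ^ (CARD('q) ^ i) else 0)" for i m
    by (simp add: fps_nth_frob_pow[OF c'])
  have "?f sums Abs_fps (\<lambda>n. \<Sum>i\<le>n. fps_nth (?f i) n)"
  proof (rule sums_fpsI)
    fix i n :: nat assume "n < i"
    then have "n < CARD('q) ^ i"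
      using less_card_power[of i, where 'q = 'q] by simp
    then show "fps_nth (?f i) n = 0"
      using L_arg_nth_0[of j F] unfolding f by (auto simp: zero_power q0 dest: dvd_imp_le)
  qed
  then have eq: "L_series j F = Abs_fps (\<lambda>n. \<Sum>i\<le>n. fps_nth (?f i) n)"
    unfolding L_series_def using exp_C_sums[OF L_arg_nth_0] sums_unique2 by blast
  have n: "n \<le> CARD('q) ^ n"
    using less_card_power[of n, where 'q = 'q] by simp
  have "fps_nth (L_series j F) (CARD('q) ^ n) = (\<Sum>i\<le>CARD('q) ^ n. if i \<le> n
      then ?D i * fps_nth ?G (CARD('q) ^ n div CARD('q) ^ i) ^ (CARD('q) ^ i) else 0)"
    unfolding eq fps_nth_Abs_fps f power_CARD_dvd_iff ..
  also have "\<dots> = (\<Sum>i\<le>n. ?D i * fps_nth ?G (CARD('q) ^ n div CARD('q) ^ i) ^ (CARD('q) ^ i))"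
    using n by (intro sum.mono_neutral_cong_right) auto
  also have "\<dots> = L_mpol_term j F n"
    unfolding L_mpol_term_def
  proof (intro sum.cong refl)
    fix i assume "i \<in> {..n}"
    then have "CARD('q) ^ n div CARD('q) ^ i = CARD('q) ^ (n - i)"
      using card_gt_1[where 'q = 'q] by (simp add: power_diff)
    then show "?D i * fps_nth ?G (CARD('q) ^ n div CARD('q) ^ i) ^ (CARD('q) ^ i) =
        ?D i * L_coeff j F (n - i) ^ (CARD('q) ^ i)"
      by (simp only: L_arg_nth(1))
  qed
  finally show "fps_nth (L_series j F) (CARD('q) ^ n) = L_mpol_term j F n" .
  show "fps_nth (L_series j F) m = 0" if m: "\<And>n. m \<noteq> CARD('q) ^ n"
  proof -
    have "fps_nth (?f i) m = 0" for i
    proof (cases "CARD('q) ^ i dvd m")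
      case True
      then obtain l where l: "m = CARD('q) ^ i * l" ..
      have "l \<noteq> CARD('q) ^ k" for k
        using m[of "i + k"] by (auto simp: l power_add)
      then have "fps_nth ?G l = 0"
        by (rule L_arg_nth(2))
      then show ?thesis
        unfolding f using q0[of i] by (simp add: l zero_power)
    qed (simp only: f if_False)
    then show ?thesis
      unfolding eq fps_nth_Abs_fps by (simp only: sum.neutral_const)
  qed
qed

lemma mpols_add: "F \<in> mpols s UNIV \<Longrightarrow> G \<in> mpols s UNIV \<Longrightarrow> F + G \<in> mpols s UNIV"
  using keys_add[of F G] by (auto simp: mpols_def)

lemma mpols_mult: "F \<in> mpols s UNIV \<Longrightarrow> G \<in> mpols s UNIV \<Longrightarrow> F * G \<in> mpols s UNIV"
  for F G :: "'a::comm_ring_1 mpol"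
proof -
  assume FG: "F \<in> mpols s UNIV" "G \<in> mpols s UNIV"
  show "F * G \<in> mpols s UNIV"
    unfolding mpols_def
  proof (intro CollectI ballI conjI UNIV_I)
    fix m assume "m \<in> Poly_Mapping.keys (F * G)"
    then obtain a b where ab: "a \<in> Poly_Mapping.keys F" "b \<in> Poly_Mapping.keys G" "m = a + b"
      using keys_mult[of F G] by blast
    then have "Poly_Mapping.keys a \<union> Poly_Mapping.keys b \<subseteq> {1..s}"
      using FG by (simp add: mpols_def)
    then show "Poly_Mapping.keys m \<subseteq> {1..s}"
      using keys_add[of a b] ab(3) by blast
  qed
qed

lemma mpols_mconst: "mconst c \<in> mpols s UNIV"
  by (cases "c = 0") (auto simp: mpols_def mconst_def)

lemma mpols_0: "0 \<in> mpols s UNIV"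
  by (simp add: mpols_def)

lemma mpols_1: "(1 :: 'a::comm_ring_1 mpol) \<in> mpols s UNIV"
  using mpols_mconst[of "1::'a" s] by (simp add: mconst_def)

lemma mpols_sum: "(\<And>x. x \<in> S \<Longrightarrow> f x \<in> mpols s UNIV) \<Longrightarrow> sum f S \<in> mpols s UNIV"
  by (induction S rule: infinite_finite_induct) (auto intro: mpols_0 mpols_add)

lemma mpols_power: "F \<in> mpols s UNIV \<Longrightarrow> F ^ n \<in> mpols s UNIV" for F :: "'a::comm_ring_1 mpol"
  by (induction n) (auto intro: mpols_1 mpols_mult)

lemma mpols_prod: "(\<And>x. x \<in> S \<Longrightarrow> f x \<in> mpols s UNIV) \<Longrightarrow> prod f S \<in> mpols s UNIV"
  for f :: "'b \<Rightarrow> 'a::comm_ring_1 mpol"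
  by (induction S rule: infinite_finite_induct) (auto intro: mpols_1 mpols_mult)

lemma mpols_mvar: "i \<in> {1..s} \<Longrightarrow> mvar i \<in> mpols s UNIV"
  by (auto simp: mpols_def mvar_def)

lemma mpols_poly_map_mconst:
  fixes x :: "'a::comm_ring_1 mpol" and h :: "'b::comm_ring_1 \<Rightarrow> 'a"
  assumes "x \<in> mpols s UNIV" "h 0 = 0"
  shows "poly (map_poly (\<lambda>b. mconst (h b)) p) x \<in> mpols s UNIV"
proof (induction p)
  case (pCons b p)
  have "mconst (h 0) = 0"
    using assms(2) by (simp add: mconst_def)
  then show ?case
    using pCons assms(1) by (simp add: map_poly_pCons mpols_add mpols_mult mpols_mconst)
qed (simp add: mpols_0)

lemma L_mpol_term_in_mpols:
  assumes F: "F \<in> mpols s UNIV" and j0: "A_emb j 0 = 0"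
  shows "L_mpol_term j F n \<in> mpols s UNIV"
proof -
  have "L_coeff j F d \<in> mpols s UNIV" for d
    unfolding L_coeff_def msubst_def
  proof (intro mpols_sum mpols_mult mpols_mconst mpols_prod mpols_power)
    fix a m i assume "m \<in> Poly_Mapping.keys F" "i \<in> Poly_Mapping.keys m"
    moreover from this have "Poly_Mapping.keys m \<subseteq> {1..s}"
      using F by (simp add: mpols_def)
    ultimately have "i \<in> {1..s}"
      by blast
    then show "carlitz_var j a i \<in> mpols s UNIV"
      unfolding carlitz_var_def by (intro mpols_poly_map_mconst mpols_mvar j0)
  qed
  then show ?thesis
    unfolding L_mpol_term_def by (intro mpols_sum mpols_mult mpols_mconst mpols_power)
qed

lemma L_series_polynomial_iff:
  fixes j :: "'q::{field,finite} fls alg_closure \<Rightarrow> 'c::field"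
  assumes c: "char_power TYPE('c) CARD('q)" and F: "F \<in> mpols s UNIV" and j0: "A_emb j 0 = 0"
  shows "L_series j F \<in> mpols_Z s \<longleftrightarrow> (\<forall>\<^sub>F n in sequentially. L_mpol_term j F n = 0)"
proof
  assume "L_series j F \<in> mpols_Z s"
  then obtain P where P: "L_series j F = fps_of_poly P"
    by (auto simp: mpols_Z_def)
  show "\<forall>\<^sub>F n in sequentially. L_mpol_term j F n = 0"
    using eventually_gt_at_top[of "degree P"]
  proof eventually_elim
    case (elim n)
    then have "degree P < CARD('q) ^ n"
      using less_card_power[of n, where 'q = 'q] by simp
    then show ?case
      using L_series_nth(1)[OF c, of j F n] by (simp add: P coeff_eq_0)
  qed
next
  assume "\<forall>\<^sub>F n in sequentially. L_mpol_term j F n = 0"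
  then obtain N where N: "\<And>n. n \<ge> N \<Longrightarrow> L_mpol_term j F n = 0"
    by (auto simp: eventually_sequentially)
  define P where "P = (\<Sum>n<N. monom (L_mpol_term j F n) (CARD('q) ^ n))"
  have inj: "CARD('q) ^ i = CARD('q) ^ n \<longleftrightarrow> i = n" for i n
    using card_gt_1[where 'q = 'q] by (simp add: power_inject_exp)
  have P: "coeff P m = fps_nth (L_series j F) m" for m
  proof (cases "\<exists>n. m = CARD('q) ^ n")
    case True
    then obtain n where n: "m = CARD('q) ^ n" ..
    have "coeff P m = (\<Sum>i<N. if i = n then L_mpol_term j F n else 0)"
      unfolding P_def coeff_sum n by (intro sum.cong) (auto simp: inj)
    also have "\<dots> = L_mpol_term j F n"
      using N[of n] by (cases "n < N") auto
    finally show ?thesis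
      by (simp only: n L_series_nth(1)[OF c])
  next
    case False
    have "coeff P m = 0"
      unfolding P_def coeff_sum using False by (intro sum.neutral) auto
    then show ?thesis
      using False L_series_nth(2)[OF c, of m j F] by simp
  qed
  have "coeff P m \<in> mpols s UNIV" for m
    unfolding P_def coeff_sum using L_mpol_term_in_mpols[OF F j0]
    by (intro mpols_sum) (simp add: mpols_0)
  moreover have "L_series j F = fps_of_poly P"
    by (rule fps_ext) (simp add: P)
  ultimately show "L_series j F \<in> mpols_Z s"
    by (auto simp: mpols_Z_def)
qed

text \<open>
  Both the substitution of \<open>C\<^sub>a\<close> and that of \<open>C\<^sub>b\<close> are composition with Carlitz polynomials, and these commute.
\<close>

lemma kronecker_L_mpol_term:
  fixes j :: "'q::{field,finite} fls alg_closure \<Rightarrow> 'c::field"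
  assumes "A_algebra (A_emb j)"
  shows "A_algebra.kronecker (A_emb j) k (L_mpol_term j F n) =
    A_algebra.L_term (A_emb j) (A_algebra.kronecker (A_emb j) k F) n"
proof -
  interpret A_algebra "A_emb j" by fact
  let ?g = "\<lambda>i. carlitz_em (theta ^ (k * i))"
  have m0: "mconst 0 = (0 :: 'c mpol)"
    by (simp add: mconst_def)
  have "mpol_eval g (poly (map_poly (\<lambda>b. mconst (A_emb j b)) p) x) = pcompose (map_poly (A_emb j) p) (mpol_eval g x)" for g p x
    by (induction p) (simp_all add: map_poly_pCons m0 mpol_eval_add mpol_eval_mult mpol_eval_mconst pcompose_pCons)
  then have var: "mpol_eval g (carlitz_var j a i) = pcompose (carlitz_em a) (g i)" for g a i
    by (simp add: carlitz_var_def carlitz_em_def mpol_eval_mvar)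
  have subst: "mpol_eval ?g (msubst F (carlitz_var j a)) = pcompose (kronecker k F) (carlitz_em a)" for a
    unfolding kronecker_def pcompose_mpol_eval mpol_eval_msubst var by (simp only: carlitz_em_commute[of a])
  have "mpol_eval ?g (L_coeff j F d) = twisted_sum (kronecker k F) d" for d
    by (simp add: L_coeff_def twisted_sum_def mpol_eval_sum mpol_eval_mult mpol_eval_mconst subst)
  then have "mpol_eval ?g (L_mpol_term j F n) = L_term (kronecker k F) n"
    by (simp add: L_mpol_term_def L_term_def exp_coeff_def mpol_eval_sum mpol_eval_mult mpol_eval_mconst mpol_eval_power)
  then show ?thesis
    by (simp only: kronecker_def)
qed

context carlitz_field
begin

text \<open>
  The values \<open>C\<^sub>b(x)\<close> are torsion points again, hence bounded by \<open>q\<close>. It matters that the bound is independent of \<open>k\<close>.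
\<close>

lemma kronecker_bounded:
  assumes x: "x \<in> torsion"
  shows "v (poly (kronecker k F) x) \<le> (\<Sum>m\<in>Poly_Mapping.keys F. v (Poly_Mapping.lookup F m) *
    (\<Prod>i\<in>Poly_Mapping.keys m. real CARD('q) ^ Poly_Mapping.lookup m i))"
    (is "_ \<le> (\<Sum>m\<in>_. ?t m)")
  unfolding kronecker_def mpol_eval_def poly_sum
proof (rule v_sum_le)
  have t0: "0 \<le> ?t m" for m
    by (intro mult_nonneg_nonneg v_nonneg prod_nonneg) auto
  then show "0 \<le> (\<Sum>m\<in>Poly_Mapping.keys F. ?t m)"
    by (intro sum_nonneg)
  fix m assume m: "m \<in> Poly_Mapping.keys F"
  have vprod: "v (\<Prod>i\<in>S. f i) = (\<Prod>i\<in>S. v (f i))" for S and f :: "nat \<Rightarrow> 'c"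
    by (induction S rule: infinite_finite_induct) (simp_all add: v_mult)
  have "v (poly (smult (Poly_Mapping.lookup F m) (mono_eval (\<lambda>i. carlitz_em (theta ^ (k * i))) m)) x) =
      v (Poly_Mapping.lookup F m) * (\<Prod>i\<in>Poly_Mapping.keys m. v (poly (carlitz_em (theta ^ (k * i))) x) ^ Poly_Mapping.lookup m i)"
    by (simp add: mono_eval_def poly_prod vprod v_mult v_power)
  also have "\<dots> \<le> ?t m"
  proof (intro mult_left_mono prod_mono conjI power_mono v_nonneg zero_le_power)
    fix i
    show "v (poly (carlitz_em (theta ^ (k * i))) x) \<le> real CARD('q)"
      using torsion_power_bound[OF torsion_carlitz[OF x], of 1] card_gt_1[where 'q = 'q] by simp
  qed
  also have "\<dots> \<le> (\<Sum>m\<in>Poly_Mapping.keys F. ?t m)"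
    using m t0 by (intro member_le_sum) auto
  finally show "v (poly (smult (Poly_Mapping.lookup F m) (mono_eval (\<lambda>i. carlitz_em (theta ^ (k * i))) m)) x)
      \<le> (\<Sum>m\<in>Poly_Mapping.keys F. ?t m)" .
qed

lemma kronecker_over_A:
  assumes "F \<in> mpols s (range em)"
  shows "kronecker k F \<in> polys_over (range em)"
  unfolding kronecker_def mpol_eval_def using assms
  by (intro polys_over_sum[OF is_subring_self[OF subring_A]] polys_over_smult[OF is_subring_self[OF subring_A]]
      mono_eval_over_A) (auto simp: mpols_def)

end

text \<open>
  For the direction from left to right one \<open>k\<close> suffices. For the other, \<open>k\<close> must be adapted to the exponents in
  \<open>T\<^sub>n(F)\<close>, which grow with \<open>n\<close>; \<open>kronecker_bounded\<close> gives a threshold for \<open>n\<close> that serves all \<open>k\<close>.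
\<close>

theorem L_mpol_term_eventually_0_iff:
  fixes j :: "'q::{field,finite} fls alg_closure \<Rightarrow> 'c::field"
  assumes "carlitz_field (A_emb j) v" and F: "F \<in> mpols s UNIV"
  shows "(\<forall>\<^sub>F n in sequentially. L_mpol_term j F n = 0) \<longleftrightarrow> F \<in> mpols s (range (A_emb j))"
proof -
  interpret carlitz_field "A_emb j" v by fact
  note A = is_subring_self[OF subring_A]
  note tm = kronecker_L_mpol_term[OF A_algebra_axioms]
  show ?thesis
  proof
    assume ev: "\<forall>\<^sub>F n in sequentially. L_mpol_term j F n = 0"
    obtain k where k: "kronecker k F \<in> polys_over (range (A_emb j)) \<Longrightarrow>
        \<forall>m\<in>Poly_Mapping.keys F. Poly_Mapping.lookup F m \<in> range (A_emb j)"
      using kronecker_reflects[OF F] A by blast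
    have "\<forall>\<^sub>F n in sequentially. L_term (kronecker k F) n = 0"
      using ev by eventually_elim (simp flip: tm, simp add: kronecker_def)
    then show "F \<in> mpols s (range (A_emb j))"
      using k[OF over_A_if_L_term_eventually_0] F by (auto simp: mpols_def)
  next
    assume FA: "F \<in> mpols s (range (A_emb j))"
    define c where "c = (\<Sum>m\<in>Poly_Mapping.keys F. v (Poly_Mapping.lookup F m) *
      (\<Prod>i\<in>Poly_Mapping.keys m. real CARD('q) ^ Poly_Mapping.lookup m i))"
    have "1 < real CARD('q)"
      using card_gt_1[where 'q = 'q] by simp
    then obtain N where N: "c < real CARD('q) ^ N"
      using real_arch_pow by blast
    show "\<forall>\<^sub>F n in sequentially. L_mpol_term j F n = 0"
      using eventually_ge_at_top[of N]
    proof eventually_elim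
      case (elim n)
      have "real CARD('q) ^ N \<le> real CARD('q) ^ n"
        using elim card_gt_1[where 'q = 'q] by (intro power_increasing) auto
      then have zero: "L_term (kronecker k F) n = 0" for k
        using N kronecker_bounded[of _ k F, folded c_def]
        by (intro L_term_eq_0[of _ c] kronecker_over_A[OF FA]) auto
      have I: "submodule_of (range (A_emb j)) {0}"
        by (auto simp: submodule_of_def)
      obtain k where k: "kronecker k (L_mpol_term j F n) \<in> polys_over {0} \<Longrightarrow>
          \<forall>m\<in>Poly_Mapping.keys (L_mpol_term j F n). Poly_Mapping.lookup (L_mpol_term j F n) m \<in> {0}"
        using kronecker_reflects[OF L_mpol_term_in_mpols[OF F]] I em_0 by blast
      have "Poly_Mapping.lookup (L_mpol_term j F n) m = 0" for m
        using k zero[of k] by (auto simp: tm polys_over_def in_keys_iff)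
      then show ?case
        by (intro poly_mapping_eqI) simp
    qed
  qed
qed

section \<open>The torsion points in the completion\<close>

lemma card_roots_separable:
  fixes p :: "'a::alg_closed_field poly"
  assumes "p \<noteq> 0" "\<And>x. poly p x = 0 \<Longrightarrow> poly (pderiv p) x \<noteq> 0"
  shows "card {x. poly p x = 0} = degree p"
  using assms
proof (induction "degree p" arbitrary: p)
  case 0
  then obtain c where "p = [:c:]"
    by (metis degree_eq_zeroE)
  then show ?case
    using 0 by simp
next
  case (Suc n)
  obtain x where x: "poly p x = 0"
    using alg_closed_imp_poly_has_root[of p] Suc.hyps(2) by auto
  then obtain r where r: "p = [:-x, 1:] * r"
    by (auto simp: poly_eq_0_iff_dvd)
  have r0: "r \<noteq> 0"
    using Suc.prems(1) r by auto
  have deg: "degree p = Suc (degree r)"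
    unfolding r using r0 by (subst degree_mult_eq) auto
  have dp: "poly (pderiv p) y = (y - x) * poly (pderiv r) y + poly r y" for y
    unfolding r by (simp only: pderiv_mult) (simp add: pderiv_pCons algebra_simps)
  have "card {x. poly r x = 0} = degree r"
  proof (rule Suc.hyps(1))
    show "n = degree r"
      using deg Suc.hyps(2) by simp
    show "poly (pderiv r) y \<noteq> 0" if "poly r y = 0" for y
      using Suc.prems(2)[of y] dp[of y] that by (auto simp: r)
  qed (rule r0)
  moreover have "{y. poly p y = 0} = insert x {y. poly r y = 0}"
    by (auto simp: r)
  moreover have "poly r x \<noteq> 0"
    using Suc.prems(2)[OF x] dp[of x] by simp
  moreover have "finite {y. poly r y = 0}"
    using r0 by (rule poly_roots_finite)
  ultimately show ?case
    using deg by simp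
qed

lemma map_poly_fls_const_pCons: "map_poly fls_const (pCons c a) = pCons (fls_const c) (map_poly fls_const a)"
  for a :: "'q::field poly"
  by (simp add: map_poly_pCons)

text \<open>
  The embedding of \<open>A\<close> into the Laurent series in \<open>1/\<theta>\<close>.
\<close>

definition A_fls :: "'q::field poly \<Rightarrow> 'q fls" where
  "A_fls a = poly (map_poly fls_const a) fls_X_inv"

lemma A_fls_0 [simp]: "A_fls 0 = 0"
  by (simp add: A_fls_def)

lemma A_fls_pCons: "A_fls (pCons c a) = fls_const c + fls_X_inv * A_fls a"
  by (simp add: A_fls_def map_poly_fls_const_pCons)

lemma A_fls_add: "A_fls (a + b) = A_fls a + A_fls b"
proof (induction a b rule: poly_induct2)
  case (pCons a p b q)
  then show ?case
    by (simp add: A_fls_pCons fls_plus_const[symmetric] algebra_simps)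
qed simp

lemma A_fls_smult: "A_fls (smult c a) = fls_const c * A_fls a"
  by (induction a) (simp_all add: A_fls_pCons algebra_simps flip: fls_const_mult_const)

lemma A_fls_mult: "A_fls (a * b) = A_fls a * A_fls b"
proof (induction a)
  case (pCons c a)
  then show ?case
    by (simp add: A_fls_add A_fls_smult A_fls_pCons algebra_simps)
qed simp

lemma A_fls_nth: "fls_nth (A_fls a) k = (if k > 0 then 0 else coeff a (nat (- k)))"
proof (induction a arbitrary: k)
  case (pCons c a)
  have "nat (- k) = Suc (nat (- (k + 1)))" if "k < 0"
    using that by simp
  then show ?case
    by (auto simp: A_fls_pCons fls_X_inv_times_conv_shift pCons.IH coeff_pCons split: nat.split)
qed simp

lemma fls_abs_A_fls:
  fixes a :: "'q::{field,finite} poly"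
  assumes "a \<noteq> 0"
  shows "fls_abs (A_fls a) = real CARD('q) ^ degree a"
proof -
  have "fls_nth (A_fls a) (- int (degree a)) = lead_coeff a"
    by (simp add: A_fls_nth)
  then have nz: "fls_nth (A_fls a) (- int (degree a)) \<noteq> 0"
    using assms by simp
  have "fls_subdegree (A_fls a) = - int (degree a)"
    by (rule fls_subdegree_eqI[OF nz]) (auto simp: A_fls_nth coeff_eq_0)
  moreover have "A_fls a \<noteq> 0"
    using nz by auto
  ultimately show ?thesis
    by (simp add: fls_abs_def)
qed

lemma A_fls_eq_0D: "A_fls a = 0 \<Longrightarrow> a = 0"
proof (rule ccontr)
  assume a: "A_fls a = 0" "a \<noteq> 0"
  have "fls_nth (A_fls a) (- int (degree a)) = lead_coeff a"
    by (simp add: A_fls_nth)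
  then show False
    using a by simp
qed

lemma A_fls_1: "A_fls 1 = 1"
  by (simp add: A_fls_def)

text \<open>
  The polynomial \<open>C\<^sub>b\<close> for \<open>b = \<theta>^D\<close> has the constant derivative \<open>\<theta>^D \<noteq> 0\<close>, so it has \<open>q^D\<close> distinct roots in the
  algebraic closure, and \<open>j\<close> maps them injectively into the completion.
\<close>

lemma C_infinity_carlitz_field:
  fixes j :: "'q::{field,finite} fls alg_closure \<Rightarrow> 'c::field"
  assumes "C_infinity j v"
  shows "carlitz_field (A_emb j) v"
proof -
  interpret C_infinity j v by fact
  have em: "A_emb j a = j (to_ac (A_fls a))" for a
    by (simp add: A_emb_def A_fls_def)
  have j0: "j 0 = 0"
    using hom_add[of 0 0] by (metis add_0 add_cancel_right_right)
  have j_nz: "x = 0" if "j x = 0" for x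
  proof (rule ccontr)
    assume "x \<noteq> 0"
    then have "j x * j (inverse x) = 1"
      by (simp flip: hom_mult add: hom_one)
    then show False
      using that by simp
  qed
  have alg: "A_algebra (A_emb j)"
    by unfold_locales
      (auto simp: em A_fls_1 hom_one A_fls_add hom_add A_fls_mult hom_mult dest!: j_nz A_fls_eq_0D)
  define em' :: "'q poly \<Rightarrow> 'q fls alg_closure" where "em' a = to_ac (A_fls a)" for a
  have alg': "A_algebra em'"
    by unfold_locales (auto simp: em'_def A_fls_1 A_fls_add A_fls_mult dest!: A_fls_eq_0D)
  interpret E: A_algebra "A_emb j" by (rule alg)
  interpret E': A_algebra em' by (rule alg')
  have inj: "inj j"
  proof (rule injI)
    fix x y assume "j x = j y"
    then have "j (x - y) = 0"
      using hom_add[of "x - y" y] by simp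
    then show "x = y"
      using j_nz by fastforce
  qed
  have card: "card {x. poly (E.carlitz_em (theta ^ D)) x = 0} = CARD('q) ^ D" for D
  proof (rule antisym)
    let ?f = "E.carlitz_em (theta ^ D)" and ?f' = "E'.carlitz_em (theta ^ D)"
    have th: "theta ^ D \<noteq> (0 :: 'q poly)"
      by simp
    have deg: "degree ?f = CARD('q) ^ D" "degree ?f' = CARD('q) ^ D"
      using E.degree_carlitz_em[OF th] E'.degree_carlitz_em[OF th] by (simp_all add: theta_power)
    then have nz: "?f \<noteq> 0" "?f' \<noteq> 0"
      using card_gt_1[where 'q = 'q] by auto
    show "card {x. poly ?f x = 0} \<le> CARD('q) ^ D"
      using card_poly_roots_bound[OF nz(1)] deg(1) by simp
    have "em' (theta ^ D) \<noteq> 0"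
      using th E'.em_eq_0_iff by blast
    then have "card {x. poly ?f' x = 0} = CARD('q) ^ D"
      using card_roots_separable[OF nz(2)] deg(2) by (simp add: E'.pderiv_carlitz_em)
    moreover have "poly (map_poly (A_emb j) p) (j x) = j (poly (map_poly em' p) x)" for p x
      by (induction p) (simp_all add: map_poly_pCons j0 hom_add hom_mult em em'_def)
    then have "j ` {x. poly ?f' x = 0} \<subseteq> {x. poly ?f x = 0}"
      by (auto simp: E.carlitz_em_def E'.carlitz_em_def j0)
    then have "card (j ` {x. poly ?f' x = 0}) \<le> card {x. poly ?f x = 0}"
      using poly_roots_finite[OF nz(1)] by (rule card_mono[rotated])
    moreover have "card (j ` {x. poly ?f' x = 0}) = card {x. poly ?f' x = 0}"
      using inj by (intro card_image) (auto intro: inj_on_subset)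
    ultimately show "CARD('q) ^ D \<le> card {x. poly ?f x = 0}"
      by simp
  qed
  show ?thesis
  proof
    show "v (A_emb j a) = real CARD('q) ^ degree a" if "a \<noteq> 0" for a
      using that by (simp add: em abs_extends fls_abs_A_fls)
  qed (use abs_nonneg abs_eq_0_iff abs_mult abs_ultrametric card in auto)
qed

theorem proposition4p18:
  fixes j :: "'q::{field,finite} fls alg_closure \<Rightarrow> 'c::field"
    and v :: "'c \<Rightarrow> real"
    and s :: nat
  assumes "C_infinity j v"
    and "s \<ge> 1"
  shows "{F \<in> mpols s UNIV. L_series j F \<in> mpols_Z s} = mpols s (range (A_emb j))"
proof -
  have field: "carlitz_field (A_emb j) v"
    by (rule C_infinity_carlitz_field[OF assms(1)])
  then interpret carlitz_field "A_emb j" v .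
  have "F \<in> mpols s UNIV" if "F \<in> mpols s (range (A_emb j))" for F
    using that by (simp add: mpols_def)
  then show ?thesis
    using L_series_polynomial_iff[OF char_power_em _ em_0] L_mpol_term_eventually_0_iff[OF field] by blast
qed

end
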